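(* There is an algorithm which, given a Laurent polynomial $f \in \mathbb{C}[x^{\pm1},y^{\pm1}]$, finds the line polynomial factors of $f$.
   Context: For $\vec{u}=(u_1,u_2)\in\mathbb{Z}^2$ write $X^{\vec{u}} = x^{u_1}y^{u_2}$; the support of a Laurent polynomial $\sum f_{\vec{u}}X^{\vec{u}}$ is the set of $\vec{u}$ with $f_{\vec{u}}\neq0$. A line polynomial is a Laurent polynomial whose support contains at least two points and all points of its support lie on a single line, i.e. its support is contained in $\vec{u}+\mathbb{Z}\vec{v}$ for some $\vec{u}\in\mathbb{Z}^2$ and some non-zero primitive $\vec{v}\in\mathbb{Z}^2$ (its direction). Factors are taken in the Laurent polynomial ring $\mathbb{C}[x^{\pm1},y^{\pm1}]$. *)

theory Defs
  imports
    Complex_Main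
    "HOL-Library.Poly_Mapping"
    "HOL-Library.Product_Plus"
    "HOL-Computational_Algebra.Fundamental_Theorem_Algebra"
begin

section \<open>Laurent polynomials and line polynomials\<close>

text \<open>
  The group algebra of \<open>\<int>\<^sup>2\<close> over the complex numbers: multiplication of polynomial mappings is
  convolution over the additive monoid of exponents, so this is the Laurent polynomial ring in
  two variables, \<^const>\<open>Poly_Mapping.keys\<close> is the support, and \<open>(dvd)\<close> is divisibility
  in that ring.
\<close>

type_synonym laurent = "(int \<times> int) \<Rightarrow>\<^sub>0 complex"

definition primitive :: "int \<times> int \<Rightarrow> bool" where
  "primitive v \<longleftrightarrow> v \<noteq> 0 \<and> coprime (fst v) (snd v)"

definition lattice_line :: "int \<times> int \<Rightarrow> int \<times> int \<Rightarrow> (int \<times> int) set" where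
  "lattice_line u v = {u + (k * fst v, k * snd v) | k. True}"

definition line_polynomial :: "laurent \<Rightarrow> bool" where
  "line_polynomial f \<longleftrightarrow>
     2 \<le> card (Poly_Mapping.keys f) \<and>
     (\<exists>u v. primitive v \<and> Poly_Mapping.keys f \<subseteq> lattice_line u v)"


section \<open>Algorithms over the complex numbers\<close>

text \<open>
  Coefficients are arbitrary complex numbers, so the model of computation is an algebraic one in
  the style of Blum, Shub and Smale: a complex number is an indivisible datum, on which a program
  can perform the field operations and test for zero. Programs are finite syntactic objects whose
  only constants are integers; apart from complex numbers they manipulate integers and
  finite trees, and they may loop forever.
\<close>

datatype val = Null | Index int | Scalar complex | Cell val val

text \<open>\<^term>\<open>Null\<close> also serves as the empty list and as the truth value false.\<close>

datatype instr =
    Ident | Head | Tail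
  | Const_null | Const_int int | To_scalar
  | Add | Subtract | Multiply | Divide
  | Is_zero | Is_negative | Is_cell
  | Roots

datatype prog =
    Basic instr
  | Seq prog prog
  | Fork prog prog
  | Cond prog prog prog
  | While prog prog

fun binary :: "(complex \<Rightarrow> complex \<Rightarrow> complex) \<Rightarrow> (int \<Rightarrow> int \<Rightarrow> int) \<Rightarrow> val \<Rightarrow> val" where
  "binary f g (Cell (Scalar a) (Scalar b)) = Scalar (f a b)"
| "binary f g (Cell (Index i) (Index j)) = Index (g i j)"
| "binary f g _ = Null"

definition truth :: "bool \<Rightarrow> val" where
  "truth b = (if b then Index 1 else Null)"

primrec list_val :: "val list \<Rightarrow> val" where
  "list_val [] = Null"
| "list_val (x # xs) = Cell x (list_val xs)"

primrec scalars_of :: "val \<Rightarrow> complex list" where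
  "scalars_of Null = []"
| "scalars_of (Index i) = []"
| "scalars_of (Scalar c) = []"
| "scalars_of (Cell x xs) = (case x of Scalar c \<Rightarrow> c | _ \<Rightarrow> 0) # scalars_of xs"

text \<open>
  The parameter \<open>R\<close> is an oracle that is consulted by \<^term>\<open>Roots\<close> only. Operations applied to
  operands of the wrong shape return \<^term>\<open>Null\<close>. Division by zero yields \<open>0\<close>, as usual in HOL;
  this adds no power, since a program can test the divisor.
\<close>

primrec instr_val :: "(complex list \<Rightarrow> complex list) \<Rightarrow> instr \<Rightarrow> val \<Rightarrow> val" where
  "instr_val R Ident x = x"
| "instr_val R Head x = (case x of Cell y z \<Rightarrow> y | _ \<Rightarrow> Null)"
| "instr_val R Tail x = (case x of Cell y z \<Rightarrow> z | _ \<Rightarrow> Null)"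
| "instr_val R Const_null x = Null"
| "instr_val R (Const_int i) x = Index i"
| "instr_val R To_scalar x = (case x of Index i \<Rightarrow> Scalar (of_int i) | _ \<Rightarrow> Null)"
| "instr_val R Add x = binary (+) (+) x"
| "instr_val R Subtract x = binary (-) (-) x"
| "instr_val R Multiply x = binary (*) (*) x"
| "instr_val R Divide x = binary (/) (div) x"
| "instr_val R Is_zero x = truth (x = Scalar 0 \<or> x = Index 0)"
| "instr_val R Is_negative x = truth (\<exists>i. x = Index i \<and> i < 0)"
| "instr_val R Is_cell x = truth (\<exists>y z. x = Cell y z)"
| "instr_val R Roots x = list_val (map Scalar (R (scalars_of x)))"

text \<open>\<open>run R P x y\<close>: program \<open>P\<close> started on input \<open>x\<close> halts with output \<open>y\<close>.\<close>

inductive run :: "(complex list \<Rightarrow> complex list) \<Rightarrow> prog \<Rightarrow> val \<Rightarrow> val \<Rightarrow> bool"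
  for R :: "complex list \<Rightarrow> complex list" where
  Basic: "run R (Basic i) x (instr_val R i x)"
| Seq: "run R P x y \<Longrightarrow> run R Q y z \<Longrightarrow> run R (Seq P Q) x z"
| Fork: "run R P x y \<Longrightarrow> run R Q x z \<Longrightarrow> run R (Fork P Q) x (Cell y z)"
| Cond_true: "run R C x t \<Longrightarrow> t \<noteq> Null \<Longrightarrow> run R P x y \<Longrightarrow> run R (Cond C P Q) x y"
| Cond_false: "run R C x Null \<Longrightarrow> run R Q x y \<Longrightarrow> run R (Cond C P Q) x y"
| While_true: "run R C x t \<Longrightarrow> t \<noteq> Null \<Longrightarrow> run R P x y \<Longrightarrow> run R (While C P) y z \<Longrightarrow>
    run R (While C P) x z"
| While_false: "run R C x Null \<Longrightarrow> run R (While C P) x x"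

inductive_cases run_BasicE: "run R (Basic i) x y"
inductive_cases run_SeqE: "run R (Seq P Q) x y"
inductive_cases run_ForkE: "run R (Fork P Q) x y"
inductive_cases run_CondE: "run R (Cond C P Q) x y"
inductive_cases run_WhileE: "run R (While C P) x y"

lemma run_deterministic: "run R P x y \<Longrightarrow> run R P x z \<Longrightarrow> y = z"
proof (induction arbitrary: z rule: run.induct)
  case (Basic i x)
  then show ?case by (rule run_BasicE) simp
next
  case (Seq P x y Q w)
  from Seq.prems show ?case by (rule run_SeqE) (use Seq.IH in blast)
next
  case (Fork P x y Q w)
  from Fork.prems show ?case by (rule run_ForkE) (use Fork.IH in blast)
next
  case (Cond_true C x t P y Q)
  from Cond_true.prems show ?case
    by (rule run_CondE) (use Cond_true.IH Cond_true.hyps in blast)+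
next
  case (Cond_false C x Q y P)
  from Cond_false.prems show ?case
    by (rule run_CondE) (use Cond_false.IH in blast)+
next
  case (While_true C x t P y w)
  from While_true.prems show ?case
    by (rule run_WhileE) (use While_true.IH While_true.hyps in blast)+
next
  case (While_false C x P)
  from While_false.prems show ?case
    by (rule run_WhileE) (use While_false.IH in blast)+
qed

primrec root_free :: "prog \<Rightarrow> bool" where
  "root_free (Basic i) \<longleftrightarrow> i \<noteq> Roots"
| "root_free (Seq P Q) \<longleftrightarrow> root_free P \<and> root_free Q"
| "root_free (Fork P Q) \<longleftrightarrow> root_free P \<and> root_free Q"
| "root_free (Cond C P Q) \<longleftrightarrow> root_free C \<and> root_free P \<and> root_free Q"
| "root_free (While C P) \<longleftrightarrow> root_free C \<and> root_free P"

text \<open>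
  A root finder maps the coefficient list (constant term first) of a non-zero univariate
  polynomial to its roots, listed with multiplicity in an unspecified order. Field operations and
  zero tests suffice for greatest common divisors, hence for one largest line polynomial factor per
  direction; splitting these further requires solving univariate equations.
\<close>

definition root_finder :: "(complex list \<Rightarrow> complex list) \<Rightarrow> bool" where
  "root_finder R \<longleftrightarrow>
     (\<forall>cs. Poly cs \<noteq> 0 \<longrightarrow> Poly cs = smult (lead_coeff (Poly cs)) (\<Prod>r\<leftarrow>R cs. [:- r, 1:]))"

lemma root_finder_exists: "\<exists>R. root_finder R"
proof -
  have "\<exists>rs. Poly cs \<noteq> 0 \<longrightarrow> Poly cs = smult (lead_coeff (Poly cs)) (\<Prod>r\<leftarrow>rs. [:- r, 1:])"
    for cs :: "complex list"
  proof (cases "Poly cs = 0")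
    case False
    then obtain A where A: "Poly cs = smult (lead_coeff (Poly cs)) (\<Prod>r\<in>#A. [:- r, 1:])"
      using alg_closed_imp_factorization by blast
    obtain rs where "mset rs = A" using ex_mset by blast
    then have "(\<Prod>r\<in>#A. [:- r, 1:]) = (\<Prod>r\<leftarrow>rs. [:- r, 1:])"
      by (metis mset_map prod_mset_prod_list)
    with A show ?thesis by metis
  qed auto
  then show ?thesis unfolding root_finder_def by metis
qed


section \<open>Laurent polynomials as inputs and outputs\<close>

text \<open>
  A Laurent polynomial is presented as a list of terms. Repeated exponents and zero coefficients
  are allowed, so a polynomial has many presentations.
\<close>

type_synonym terms = "((int \<times> int) \<times> complex) list"

definition laurent_of :: "terms \<Rightarrow> laurent" where
  "laurent_of ts = (\<Sum>(u, c)\<leftarrow>ts. Poly_Mapping.single u c)"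

fun term_val :: "(int \<times> int) \<times> complex \<Rightarrow> val" where
  "term_val ((i, j), c) = Cell (Cell (Index i) (Index j)) (Scalar c)"

definition terms_val :: "terms \<Rightarrow> val" where
  "terms_val ts = list_val (map term_val ts)"

definition terms_list_val :: "terms list \<Rightarrow> val" where
  "terms_list_val tss = list_val (map terms_val tss)"

lemma laurent_of_surj: "\<exists>ts. laurent_of ts = f"
proof -
  obtain us where us: "set us = Poly_Mapping.keys f" "distinct us"
    using finite_distinct_list[OF finite_keys[of f]] by metis
  let ?c = "\<lambda>u. Poly_Mapping.single u (Poly_Mapping.lookup f u)"
  have "laurent_of (map (\<lambda>u. (u, Poly_Mapping.lookup f u)) us) = sum_list (map ?c us)"
    by (simp add: laurent_of_def case_prod_beta comp_def)
  also have "\<dots> = (\<Sum>u\<in>Poly_Mapping.keys f. ?c u)"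
    by (simp only: sum_list_distinct_conv_sum_set[OF us(2)] us(1))
  also have "\<dots> = f"
  proof (rule poly_mapping_eqI)
    fix w
    have "Poly_Mapping.lookup (\<Sum>u\<in>Poly_Mapping.keys f. ?c u) w =
        (\<Sum>u\<in>Poly_Mapping.keys f. if u = w then Poly_Mapping.lookup f u else 0)"
      by (simp only: lookup_sum lookup_single when_def)
    then show "Poly_Mapping.lookup (\<Sum>u\<in>Poly_Mapping.keys f. ?c u) w = Poly_Mapping.lookup f w"
      by (simp add: in_keys_iff)
  qed
  finally show ?thesis by (rule exI)
qed

end

theory Submission
  imports Defs "HOL-Library.Product_Lexorder"
begin

text \<open>
  Let \<open>h\<close> be supported on a line of direction \<open>v\<close>. Multiplication by \<open>h\<close> shifts the cosets of
  \<open>\<int>v\<close>, so \<open>h\<close> divides \<open>f\<close> iff it divides the restriction of \<open>f\<close> to every coset. Up to units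
  these restrictions are univariate polynomials in \<open>X\<^sup>v\<close>, and their greatest common divisor is the
  largest factor of \<open>f\<close> of direction \<open>v\<close>. A line polynomial divides no monomial, hence if \<open>h\<close>
  is one and \<open>f \<noteq> 0\<close>, two exponents of \<open>f\<close> differ by a multiple of \<open>v\<close>, and it suffices to
  try all non-zero \<open>v\<close> in a box. Vectors \<open>v\<close> that are not primitive need not be sorted out: they
  yield further line polynomial factors. Over a root finder the greatest common divisor is, up to
  a unit, a product of factors \<open>X\<^sup>v - r\<close> with \<open>r \<noteq> 0\<close>, each of which is prime among the Laurent
  polynomials supported on lines of direction \<open>v\<close>.
\<close>

section \<open>Computable functions between encoded types\<close>

text \<open>Selects the encoding of a datum by its type, so that a program can be specified by the
  HOL function it computes.\<close>

class encodable =
  fixes enc :: "'a \<Rightarrow> val"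

instantiation int :: encodable
begin
definition enc_int :: "int \<Rightarrow> val" where [simp]: "enc_int = Index"
instance ..
end

instantiation complex :: encodable
begin
definition enc_complex :: "complex \<Rightarrow> val" where [simp]: "enc_complex = Scalar"
instance ..
end

instantiation bool :: encodable
begin
definition enc_bool :: "bool \<Rightarrow> val" where [simp]: "enc_bool = truth"
instance ..
end

instantiation prod :: (encodable, encodable) encodable
begin
definition enc_prod :: "'a \<times> 'b \<Rightarrow> val" where [simp]: "enc_prod p = Cell (enc (fst p)) (enc (snd p))"
instance ..
end

instantiation list :: (encodable) encodable
begin
definition enc_list :: "'a list \<Rightarrow> val" where [simp]: "enc_list xs = list_val (map enc xs)"
instance ..
end

text \<open>Connects the type-directed encoding with the input format that the theorem
  prescribes.\<close>

lemma enc_terms: "enc (ts :: terms) = terms_val ts"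
proof -
  have "enc t = term_val t" for t :: "(int \<times> int) \<times> complex"
    by (cases t rule: term_val.cases) simp
  then have "map enc ts = map term_val ts" by (intro map_cong refl)
  then show ?thesis unfolding terms_val_def enc_list_def by (rule arg_cong)
qed

lemma enc_terms_list: "enc (tss :: terms list) = terms_list_val tss"
proof -
  have "map enc tss = map terms_val tss" by (intro map_cong refl enc_terms)
  then show ?thesis unfolding terms_list_val_def enc_list_def by (rule arg_cong)
qed

text \<open>
  The first argument of a computable function is the root oracle, so that one program serves all
  oracles; the flag asks for a program that does not consult it.
\<close>

definition computable ::
    "bool \<Rightarrow> ((complex list \<Rightarrow> complex list) \<Rightarrow> 'a::encodable \<Rightarrow> 'b::encodable) \<Rightarrow> bool" where
  "computable b f \<longleftrightarrow> (\<exists>P. (b \<longrightarrow> root_free P) \<and> (\<forall>R x. run R P (enc x) (enc (f R x))))"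

section \<open>Basic instructions and composition\<close>

lemma computableI:
  assumes "b \<longrightarrow> root_free P" and "\<And>R x. run R P (enc x) (enc (f R x))"
  shows "computable b f"
  using assms unfolding computable_def by blast

lemma computableE:
  assumes "computable b f"
  obtains P where "b \<longrightarrow> root_free P" and "\<And>R x. run R P (enc x) (enc (f R x))"
  using assms unfolding computable_def by blast

lemma run_Basic_eq: "y = instr_val R i x \<Longrightarrow> run R (Basic i) x y"
  by (simp add: run.Basic)

lemma computable_Basic:
  assumes "b \<longrightarrow> i \<noteq> Roots" and "\<And>R x. enc (f R x) = instr_val R i (enc x)"
  shows "computable b f"
  by (rule computableI[where P = "Basic i"]) (use assms in \<open>auto intro: run_Basic_eq\<close>)

lemma computable_comp:
  assumes "computable b f" and "computable b g"
  shows "computable b (\<lambda>R x. g R (f R x))"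
proof -
  obtain P where P: "b \<longrightarrow> root_free P" "\<And>R x. run R P (enc x) (enc (f R x))"
    using assms(1) by (rule computableE) blast
  obtain Q where Q: "b \<longrightarrow> root_free Q" "\<And>R x. run R Q (enc x) (enc (g R x))"
    using assms(2) by (rule computableE) blast
  show ?thesis
    by (rule computableI[where P = "Seq P Q"]) (use P(1) Q(1) in simp, rule run.Seq[OF P(2) Q(2)])
qed

named_theorems computable_intros

lemma computable_id [computable_intros]: "computable b (\<lambda>R x. x)"
  by (rule computable_Basic[where i = Ident]) simp_all

lemma computable_Pair [computable_intros]:
  assumes "computable b f" and "computable b g"
  shows "computable b (\<lambda>R x. (f R x, g R x))"
proof -
  obtain P where P: "b \<longrightarrow> root_free P" "\<And>R x. run R P (enc x) (enc (f R x))"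
    using assms(1) by (rule computableE) blast
  obtain Q where Q: "b \<longrightarrow> root_free Q" "\<And>R x. run R Q (enc x) (enc (g R x))"
    using assms(2) by (rule computableE) blast
  show ?thesis
    by (rule computableI[where P = "Fork P Q"]) (use P(1) Q(1) in simp, simp add: run.Fork[OF P(2) Q(2)])
qed

text \<open>Pairing reduces a binary function to composition. A rule proved once for the two
  projections of a pair can thus be applied to arbitrary computable arguments.\<close>

lemma computable_comp2:
  assumes "computable b (\<lambda>R p. h R (fst p) (snd p))" and "computable b f" and "computable b g"
  shows "computable b (\<lambda>R x. h R (f R x) (g R x))"
  using computable_comp[OF computable_Pair[OF assms(2,3)] assms(1)] by simp

lemma computable_comp3:
  assumes "computable b (\<lambda>R p. h R (fst p) (fst (snd p)) (snd (snd p)))"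
    and "computable b f" and "computable b g" and "computable b k"
  shows "computable b (\<lambda>R x. h R (f R x) (g R x) (k R x))"
  using computable_comp[OF computable_Pair[OF assms(2) computable_Pair[OF assms(3,4)]] assms(1)]
  by simp

lemma computable_fst [computable_intros]:
  assumes "computable b f"
  shows "computable b (\<lambda>R x. fst (f R x))"
  by (rule computable_comp[OF assms]) (rule computable_Basic[where i = Head], simp_all)

lemma computable_snd [computable_intros]:
  assumes "computable b f"
  shows "computable b (\<lambda>R x. snd (f R x))"
  by (rule computable_comp[OF assms]) (rule computable_Basic[where i = Tail], simp_all)

lemma computable_int_const: "computable b (\<lambda>R x. k :: int)"
  by (rule computable_Basic[where i = "Const_int k"]) simp_all

lemmas computable_int_consts [computable_intros] =
  computable_int_const[of _ 0] computable_int_const[of _ 1] computable_int_const[of _ "numeral n"] for n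

lemma computable_complex_of_int:
  assumes "computable b f"
  shows "computable b (\<lambda>R x. of_int (f R x) :: complex)"
  by (rule computable_comp[OF assms]) (rule computable_Basic[where i = To_scalar], simp_all)

lemma computable_complex_0 [computable_intros]: "computable b (\<lambda>R x. 0 :: complex)"
  using computable_complex_of_int[OF computable_int_const[of b 0]] by simp

lemma computable_complex_1 [computable_intros]: "computable b (\<lambda>R x. 1 :: complex)"
  using computable_complex_of_int[OF computable_int_const[of b 1]] by simp

lemma computable_Nil [computable_intros]: "computable b (\<lambda>R x. [])"
  by (rule computable_Basic[where i = Const_null]) simp_all

lemma computable_False [computable_intros]: "computable b (\<lambda>R x. False)"
  by (rule computable_Basic[where i = Const_null]) (simp_all add: truth_def)

lemma computable_True [computable_intros]: "computable b (\<lambda>R x. True)"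
  by (rule computable_Basic[where i = "Const_int 1"]) (simp_all add: truth_def)

lemma computable_Cons [computable_intros]:
  assumes "computable b f" and "computable b g"
  shows "computable b (\<lambda>R x. f R x # g R x)"
  \<comment> \<open>A nonempty list has the same encoding as the pair of its head and tail, so the
    identity instruction acts as the list constructor.\<close>
  by (rule computable_comp2[OF _ assms]) (rule computable_Basic[where i = Ident], simp_all)

lemma computable_int_arith [computable_intros]:
  fixes f g :: "_ \<Rightarrow> _ \<Rightarrow> int"
  assumes "computable b f" and "computable b g"
  shows "computable b (\<lambda>R x. f R x + g R x)" and "computable b (\<lambda>R x. f R x - g R x)"
    and "computable b (\<lambda>R x. f R x * g R x)"
  by (rule computable_comp2[OF _ assms], rule computable_Basic[where i = Add], simp_all)
    (rule computable_comp2[OF _ assms], rule computable_Basic[where i = Subtract], simp_all,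
     rule computable_comp2[OF _ assms], rule computable_Basic[where i = Multiply], simp_all)

lemma computable_complex_arith [computable_intros]:
  fixes f g :: "_ \<Rightarrow> _ \<Rightarrow> complex"
  assumes "computable b f" and "computable b g"
  shows "computable b (\<lambda>R x. f R x + g R x)" and "computable b (\<lambda>R x. f R x - g R x)"
    and "computable b (\<lambda>R x. f R x * g R x)" and "computable b (\<lambda>R x. f R x / g R x)"
  by (rule computable_comp2[OF _ assms], rule computable_Basic[where i = Add], simp_all)
    (rule computable_comp2[OF _ assms], rule computable_Basic[where i = Subtract], simp_all,
     rule computable_comp2[OF _ assms], rule computable_Basic[where i = Multiply], simp_all,
     rule computable_comp2[OF _ assms], rule computable_Basic[where i = Divide], simp_all)

text \<open>The only order test among the instructions is the sign of one integer, so the difference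
  is formed first.\<close>

lemma computable_int_less [computable_intros]:
  fixes f g :: "_ \<Rightarrow> _ \<Rightarrow> int"
  assumes "computable b f" and "computable b g"
  shows "computable b (\<lambda>R x. f R x < g R x)"
proof -
  have "computable b (\<lambda>R x. f R x - g R x < 0)"
    by (rule computable_comp[OF computable_int_arith(2)[OF assms]])
      (rule computable_Basic[where i = Is_negative], simp_all)
  then show ?thesis by simp
qed

lemma computable_int_eq [computable_intros]:
  fixes f g :: "_ \<Rightarrow> _ \<Rightarrow> int"
  assumes "computable b f" and "computable b g"
  shows "computable b (\<lambda>R x. f R x = g R x)"
proof -
  have "computable b (\<lambda>R x. f R x - g R x = 0)"
    by (rule computable_comp[OF computable_int_arith(2)[OF assms]])
      (rule computable_Basic[where i = Is_zero], simp_all)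
  then show ?thesis by simp
qed

lemma computable_complex_eq [computable_intros]:
  fixes f g :: "_ \<Rightarrow> _ \<Rightarrow> complex"
  assumes "computable b f" and "computable b g"
  shows "computable b (\<lambda>R x. f R x = g R x)"
proof -
  have "computable b (\<lambda>R x. f R x - g R x = 0)"
    by (rule computable_comp[OF computable_complex_arith(2)[OF assms]])
      (rule computable_Basic[where i = Is_zero], simp_all)
  then show ?thesis by simp
qed

lemma computable_If [computable_intros]:
  assumes "computable b c" and "computable b f" and "computable b g"
  shows "computable b (\<lambda>R x. if c R x then f R x else g R x)"
proof -
  obtain C where C: "b \<longrightarrow> root_free C" "\<And>R x. run R C (enc x) (enc (c R x))"
    using assms(1) by (rule computableE) blast
  obtain P where P: "b \<longrightarrow> root_free P" "\<And>R x. run R P (enc x) (enc (f R x))"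
    using assms(2) by (rule computableE) blast
  obtain Q where Q: "b \<longrightarrow> root_free Q" "\<And>R x. run R Q (enc x) (enc (g R x))"
    using assms(3) by (rule computableE) blast
  show ?thesis
  proof (rule computableI[where P = "Cond C P Q"])
    fix R x
    show "run R (Cond C P Q) (enc x) (enc (if c R x then f R x else g R x))"
      using C(2)[of R x] P(2)[of R x] Q(2)[of R x]
      by (cases "c R x") (auto simp: truth_def intro: run.Cond_true run.Cond_false)
  qed (use C P Q in simp)
qed

lemma computable_Not [computable_intros]:
  assumes "computable b c"
  shows "computable b (\<lambda>R x. \<not> c R x)"
  using computable_If[OF assms computable_False computable_True] by (simp add: if_bool_eq_conj)

lemma computable_conj [computable_intros]:
  assumes "computable b c" and "computable b d"
  shows "computable b (\<lambda>R x. c R x \<and> d R x)"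
proof -
  have "computable b (\<lambda>R x. if c R x then d R x else False)"
    by (intro computable_If computable_False assms)
  moreover have "(\<lambda>R x. if c R x then d R x else False) = (\<lambda>R x. c R x \<and> d R x)"
    by (intro ext) simp
  ultimately show ?thesis by simp
qed

section \<open>Case distinction on lists and loops\<close>

lemma computable_case_list [computable_intros]:
  assumes "computable b f" and "computable b g"
    and "computable b (\<lambda>R p. h R (fst p) (fst (snd p)) (snd (snd p)))"
  shows "computable b (\<lambda>R x. case_list (g R x) (h R x) (f R x))"
proof -
  obtain C where C: "b \<longrightarrow> root_free C" "\<And>R x. run R C (enc x) (enc (f R x))"
    using assms(1) by (rule computableE) blast
  obtain P where P: "b \<longrightarrow> root_free P" "\<And>R x. run R P (enc x) (enc (g R x))"
    using assms(2) by (rule computableE) blast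
  obtain Q where Q: "b \<longrightarrow> root_free Q"
      "\<And>R p. run R Q (enc p) (enc (h R (fst p) (fst (snd p)) (snd (snd p))))"
    using assms(3) by (rule computableE) blast
  show ?thesis
  \<comment> \<open>Since \<open>y # ys\<close> and \<open>(y, ys)\<close> have the same encoding,
    \<open>Fork (Basic Ident) C\<close> already produces the encoded triple
    \<open>(x, y, ys)\<close> on which \<open>Q\<close> works.\<close>
  proof (rule computableI[where P = "Cond (Seq C (Basic Is_cell)) (Seq (Fork (Basic Ident) C) Q) P"])
    fix R x
    show "run R (Cond (Seq C (Basic Is_cell)) (Seq (Fork (Basic Ident) C) Q) P) (enc x)
        (enc (case_list (g R x) (h R x) (f R x)))"
    proof (cases "f R x")
      case Nil
      then have "run R C (enc x) Null" using C(2)[of R x] by simp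
      then have "run R (Seq C (Basic Is_cell)) (enc x) Null"
        by (rule run.Seq) (simp add: run_Basic_eq truth_def)
      then show ?thesis using P(2)[of R x] Nil by (auto intro: run.Cond_false)
    next
      case (Cons y ys)
      have "run R (Seq C (Basic Is_cell)) (enc x) (Index 1)"
        using C(2)[of R x] by (rule run.Seq) (simp add: Cons run_Basic_eq truth_def)
      moreover have "run R (Seq (Fork (Basic Ident) C) Q) (enc x) (enc (h R x y ys))"
        using run.Seq[OF run.Fork[OF run_Basic_eq[of "enc x" R Ident "enc x"] C(2)[of R x]], of Q]
          Q(2)[of R "(x, y, ys)"] Cons by simp
      ultimately show ?thesis using Cons by (auto intro: run.Cond_true)
    qed
  qed (use C P Q in simp)
qed

text \<open>The tail-recursive \<open>f\<close> is given by its unfolding equation only. The measure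
  \<open>m\<close> bounds the number of iterations and carries the induction that yields a halting
  run.\<close>

lemma computable_while:
  fixes m :: "(complex list \<Rightarrow> complex list) \<Rightarrow> 'a::encodable \<Rightarrow> nat"
  assumes "computable b c" and "computable b g"
    and decreasing: "\<And>R s. c R s \<Longrightarrow> m R (g R s) < m R s"
    and unfold: "\<And>R s. f R s = (if c R s then f R (g R s) else s)"
  shows "computable b f"
proof -
  obtain C where C: "b \<longrightarrow> root_free C" "\<And>R x. run R C (enc x) (enc (c R x))"
    using assms(1) by (rule computableE) blast
  obtain P where P: "b \<longrightarrow> root_free P" "\<And>R x. run R P (enc x) (enc (g R x))"
    using assms(2) by (rule computableE) blast
  show ?thesis
  proof (rule computableI[where P = "While C P"])
    fix R s
    show "run R (While C P) (enc s) (enc (f R s))"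
    proof (induction "m R s" arbitrary: s rule: less_induct)
      case less
      show ?case
      proof (cases "c R s")
        case True
        then have "run R (While C P) (enc (g R s)) (enc (f R s))"
          using less[OF decreasing] by (subst unfold) simp
        moreover have "run R C (enc s) (Index 1)"
          using C(2)[of R s] True by (simp add: truth_def)
        ultimately show ?thesis
          using P(2)[of R s] by (auto intro: run.While_true)
      next
        case False
        then have "f R s = s" by (subst unfold) simp
        then show ?thesis
          using C(2)[of R s] False by (auto simp: truth_def intro: run.While_false)
      qed
    qed
  qed (use C P in simp)
qed

lemma computable_fold [computable_intros]:
  fixes f :: "_ \<Rightarrow> 'a::encodable \<Rightarrow> 'c::encodable list" and g :: "_ \<Rightarrow> _ \<Rightarrow> 'd::encodable"
  assumes f: "computable b f" and g: "computable b g"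
    and h: "computable b (\<lambda>R p. h R (fst p) (fst (snd p)) (snd (snd p)))"
  shows "computable b (\<lambda>R x. fold (h R x) (f R x) (g R x))"
proof -
  \<comment> \<open>A loop body sees nothing but its state, which therefore holds the parameter, the
    unread rest of the list and the accumulator.\<close>
  let ?loop = "\<lambda>R (s :: 'a \<times> 'c list \<times> 'd). (fst s, [] :: 'c list, fold (h R (fst s)) (fst (snd s)) (snd (snd s)))"
  let ?step = "\<lambda>R (s :: 'a \<times> 'c list \<times> 'd). case fst (snd s) of [] \<Rightarrow> s
    | y # ys \<Rightarrow> (fst s, ys, h R (fst s) y (snd (snd s)))"
  \<comment> \<open>Turns the hypothesis on \<open>h\<close>, which speaks of projections of a
    tuple, into a closure rule that \<open>intro\<close> can apply inside
    \<open>?step\<close>.\<close>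
  have h': "computable b (\<lambda>R x. h R (f' R x) (g' R x) (k' R x))"
    if "computable b f'" "computable b g'" "computable b k'"
    for f' :: "_ \<Rightarrow> ('a \<times> 'c list \<times> 'd) \<times> 'c \<times> 'c list \<Rightarrow> 'a" and g' k'
    by (rule computable_comp3[OF h that])
  have "computable b ?loop"
  proof (rule computable_while[where m = "\<lambda>R s. length (fst (snd s))" and g = ?step
        and c = "\<lambda>R (s :: 'a \<times> 'c list \<times> 'd). case fst (snd s) of [] \<Rightarrow> False | y # ys \<Rightarrow> True"])
    show "computable b ?step" by (intro computable_intros h')
    show "computable b (\<lambda>R (s :: 'a \<times> 'c list \<times> 'd).
        case fst (snd s) of [] \<Rightarrow> False | y # ys \<Rightarrow> True)"
      by (intro computable_intros)
  qed (auto split: list.split)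
  from computable_snd[OF computable_snd[OF computable_comp[OF computable_Pair[OF computable_id
          computable_Pair[OF f g]] this]]]
  show ?thesis by simp
qed

section \<open>Standard list functions\<close>

lemma computable_rev [computable_intros]:
  assumes "computable b f"
  shows "computable b (\<lambda>R x. rev (f R x))"
  using assms unfolding rev_conv_fold by (intro computable_intros)

lemma computable_foldr [computable_intros]:
  assumes "computable b f" and "computable b g"
    and "computable b (\<lambda>R p. h R (fst p) (fst (snd p)) (snd (snd p)))"
  shows "computable b (\<lambda>R x. foldr (h R x) (f R x) (g R x))"
  unfolding foldr_conv_fold by (intro computable_intros assms)

lemma map_conv_foldr: "map f xs = foldr (\<lambda>x ys. f x # ys) xs []"
  by (induction xs) simp_all

lemma computable_map [computable_intros]:
  assumes "computable b f" and "computable b (\<lambda>R p. h R (fst p) (snd p))"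
  shows "computable b (\<lambda>R x. map (h R x) (f R x))"
proof -
  have h': "computable b (\<lambda>R x. h R (f' R x) (g' R x))"
    if "computable b f'" "computable b g'" for f' g'
    by (rule computable_comp2[OF assms(2) that])
  show ?thesis unfolding map_conv_foldr by (intro computable_intros assms(1) h')
qed

lemma computable_append [computable_intros]:
  fixes f :: "_ \<Rightarrow> _ \<Rightarrow> 'c::encodable list"
  assumes "computable b f" and "computable b g"
  shows "computable b (\<lambda>R x. f R x @ g R x)"
proof -
  have "computable b (\<lambda>R x. foldr Cons (f R x) (g R x))" by (intro computable_intros assms)
  moreover have "foldr Cons xs ys = xs @ ys" for xs ys :: "'c list"
    by (induction xs) simp_all
  ultimately show ?thesis by simp
qed

lemma computable_concat [computable_intros]:
  assumes "computable b f"
  shows "computable b (\<lambda>R x. concat (f R x))"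
  by (rule computable_comp[OF assms], unfold concat_conv_foldr) (intro computable_intros)

lemma filter_conv_foldr: "filter P xs = foldr (\<lambda>x ys. if P x then x # ys else ys) xs []"
  by (induction xs) simp_all

lemma computable_filter [computable_intros]:
  fixes f :: "_ \<Rightarrow> 'a::encodable \<Rightarrow> 'c::encodable list"
  assumes "computable b f" and "computable b (\<lambda>R p. h R (fst p) (snd p))"
  shows "computable b (\<lambda>R x. filter (h R x) (f R x))"
proof -
  have h': "computable b (\<lambda>R x. h R (f' R x) (g' R x))"
    if "computable b f'" "computable b g'" for f' :: "_ \<Rightarrow> 'a \<times> 'c \<times> 'c list \<Rightarrow> 'a" and g'
    by (rule computable_comp2[OF assms(2) that])
  show ?thesis unfolding filter_conv_foldr by (intro computable_intros assms(1) h')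
qed

lemma computable_eq_Nil [computable_intros]:
  fixes f :: "_ \<Rightarrow> _ \<Rightarrow> 'c::encodable list"
  assumes "computable b f"
  shows "computable b (\<lambda>R x. f R x = [])"
proof -
  have "computable b (\<lambda>R x. case f R x of [] \<Rightarrow> True | y # ys \<Rightarrow> False)"
    by (intro computable_intros assms)
  moreover have "(case xs of [] \<Rightarrow> True | y # ys \<Rightarrow> False) \<longleftrightarrow> xs = []" for xs :: "'c list"
    by (cases xs) simp_all
  ultimately show ?thesis by simp
qed

lemma computable_upto [computable_intros]:
  assumes "computable b f" and "computable b g"
  shows "computable b (\<lambda>R x. [f R x..g R x])"
proof -
  \<comment> \<open>The upper bound descends, so that adding at the front of the accumulator leaves
    it increasing. The first branch is there because a loop whose guard fails at once returns its
    state unchanged.\<close>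
  let ?loop = "\<lambda>R (s :: int \<times> int \<times> int list). if fst (snd s) < fst s then s
    else (fst s, fst s - 1, [fst s..fst (snd s)] @ snd (snd s))"
  have "computable b ?loop"
  proof (rule computable_while[where c = "\<lambda>R s. \<not> fst (snd s) < fst s"
        and m = "\<lambda>R s. nat (fst (snd s) + 1 - fst s)"
        and g = "\<lambda>R s. (fst s, fst (snd s) - 1, fst (snd s) # snd (snd s))"])
    show "computable b (\<lambda>R (s :: int \<times> int \<times> int list). \<not> fst (snd s) < fst s)"
      and "computable b (\<lambda>R (s :: int \<times> int \<times> int list). (fst s, fst (snd s) - 1, fst (snd s) # snd (snd s)))"
      by (intro computable_intros)+
  qed (auto simp: upto_rec2)
  from computable_snd[OF computable_snd[OF computable_comp[OF computable_Pair[OF assms(1)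
          computable_Pair[OF assms(2) computable_Nil]] this]]]
  have "computable b (\<lambda>R x. if g R x < f R x then [] else [f R x..g R x])"
    by (simp add: if_distrib cong: if_cong)
  moreover have "(\<lambda>R x. if g R x < f R x then [] else [f R x..g R x]) = (\<lambda>R x. [f R x..g R x])"
    by (intro ext) simp
  ultimately show ?thesis by simp
qed

text \<open>The one primitive that consults the oracle, hence stated for the flag
  \<open>False\<close>.\<close>

lemma computable_roots:
  assumes "computable False f"
  shows "computable False (\<lambda>R x. R (f R x))"
proof (rule computable_comp[where g = "\<lambda>R cs. R cs", OF assms],
    rule computable_Basic[where i = Roots])
  fix R :: "complex list \<Rightarrow> complex list" and cs :: "complex list"
  have "scalars_of (enc cs) = cs" by (induction cs) simp_all
  then show "enc (R cs) = instr_val R Roots (enc cs)" by (simp add: enc_complex_def[abs_def])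
qed simp

section \<open>The algorithm as a functional program\<close>

text \<open>Adds up all occurrences of an exponent, because a presentation may repeat it.
  Coordinates are compared one by one, since the available equality tests are for numbers and not
  for pairs.\<close>

definition coef :: "terms \<Rightarrow> int \<times> int \<Rightarrow> complex" where
  "coef ts u = foldr (\<lambda>t s. if fst (fst t) = fst u \<and> snd (fst t) = snd u then snd t + s else s) ts 0"

lemma computable_coef [computable_intros]:
  assumes "computable b f" and "computable b g"
  shows "computable b (\<lambda>R x. coef (f R x) (g R x))"
  by (rule computable_comp2[OF _ assms], unfold coef_def) (intro computable_intros)

lemma computable_abs [computable_intros]:
  fixes f :: "_ \<Rightarrow> _ \<Rightarrow> int"
  assumes "computable b f"
  shows "computable b (\<lambda>R x. \<bar>f R x\<bar>)"
proof -
  have "\<bar>i\<bar> = (if i < 0 then 0 - i else i)" for i :: int by simp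
  then show ?thesis by (simp only:) (intro computable_intros assms)
qed

text \<open>A crude bound that needs no maximum: it dominates twice every coordinate of every listed
  exponent, hence also every coordinate of a difference of two exponents.\<close>

definition radius :: "terms \<Rightarrow> int" where
  "radius ts = foldr (\<lambda>t s. 2 * (\<bar>fst (fst t)\<bar> + \<bar>snd (fst t)\<bar>) + s) ts 0"

lemma computable_radius [computable_intros]:
  assumes "computable b f"
  shows "computable b (\<lambda>R x. radius (f R x))"
  by (rule computable_comp[OF assms], unfold radius_def) (intro computable_intros)

definition window :: "terms \<Rightarrow> int list" where
  "window ts = [0 - radius ts..radius ts]"

lemma computable_window [computable_intros]:
  assumes "computable b f"
  shows "computable b (\<lambda>R x. window (f R x))"
  unfolding window_def by (intro computable_intros assms)

definition directions :: "terms \<Rightarrow> (int \<times> int) list" where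
  "directions ts = filter (\<lambda>v. \<not> (fst v = 0 \<and> snd v = 0))
     (concat (map (\<lambda>i. map (\<lambda>j. (i, j)) (window ts)) (window ts)))"

lemma computable_directions [computable_intros]:
  assumes "computable b f"
  shows "computable b (\<lambda>R x. directions (f R x))"
  by (rule computable_comp[OF assms], unfold directions_def) (intro computable_intros)

text \<open>Coefficients on the coset of \<open>u\<close>, starting at index
  \<open>- radius ts\<close>, padded with zeros. For \<open>v \<noteq> 0\<close> and a listed
  exponent \<open>u\<close> the window covers the whole fibre.\<close>

definition slice :: "terms \<Rightarrow> int \<times> int \<Rightarrow> int \<times> int \<Rightarrow> complex list" where
  "slice ts v u = map (\<lambda>k. coef ts (fst u + k * fst v, snd u + k * snd v)) (window ts)"

lemma computable_slice [computable_intros]: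
  assumes "computable b f" and "computable b g" and "computable b k"
  shows "computable b (\<lambda>R x. slice (f R x) (g R x) (k R x))"
  by (rule computable_comp3[OF _ assms], unfold slice_def) (intro computable_intros)

section \<open>Euclid's algorithm on coefficient lists\<close>

fun sub_scaled :: "complex list \<Rightarrow> complex \<Rightarrow> complex list \<Rightarrow> complex list" where
  "sub_scaled [] c q = []"
| "sub_scaled (a # p) c [] = a # p"
| "sub_scaled (a # p) c (b # q) = (a - c * b) # sub_scaled p c q"

lemma length_sub_scaled [simp]: "length (sub_scaled p c q) = length p"
  by (induction p c q rule: sub_scaled.induct) simp_all

text \<open>Simultaneous recursion on two lists becomes a fold over the first, whose state holds the
  unread part of \<open>q\<close> and the reversed result; folds are known to be computable.\<close>

lemma sub_scaled_conv_fold: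
  "sub_scaled p c q = rev (snd (fold (\<lambda>a s. case fst s of [] \<Rightarrow> ([], a # snd s)
     | b # bs \<Rightarrow> (bs, (a - c * b) # snd s)) p (q, [])))" (is "_ = rev (snd (fold ?step p _))")
proof -
  have [simp]: "fold ?step p ([], s) = ([], rev p @ s)" for p s
    by (induction p arbitrary: s) simp_all
  have "fold ?step p (q, s) = (drop (length p) q, rev (sub_scaled p c q) @ s)" for s
  proof (induction p arbitrary: q s)
    case (Cons a p)
    then show ?case by (cases q) simp_all
  qed simp
  then show ?thesis by simp
qed

lemma computable_sub_scaled [computable_intros]:
  assumes "computable b f" and "computable b g" and "computable b k"
  shows "computable b (\<lambda>R x. sub_scaled (f R x) (g R x) (k R x))"
  by (rule computable_comp3[OF _ assms], unfold sub_scaled_conv_fold) (intro computable_intros)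

lemma computable_length [computable_intros]:
  fixes f :: "_ \<Rightarrow> _ \<Rightarrow> 'c::encodable list"
  assumes "computable b f"
  shows "computable b (\<lambda>R x. int (length (f R x)))"
proof -
  have "int (length xs) = foldr (\<lambda>x n. n + 1) xs 0" for xs :: "'c list"
    by (induction xs) simp_all
  moreover have "computable b (\<lambda>R x. foldr (\<lambda>x n. n + 1) (f R x) (0 :: int))"
    by (intro computable_intros assms)
  ultimately show ?thesis by simp
qed

text \<open>Euclid's algorithm run at the constant terms instead of the leading ones: a zero head is
  dropped, and otherwise a list at least as long as the other one loses its head.\<close>

definition cgcd_step :: "complex list \<times> complex list \<Rightarrow> complex list \<times> complex list" where
  "cgcd_step s = (case fst s of [] \<Rightarrow> s | a # p \<Rightarrow> (case snd s of [] \<Rightarrow> s | b # q \<Rightarrow>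
     if a = 0 then (p, b # q)
     else if b = 0 then (a # p, q)
     else if int (length p) < int (length q) then (a # p, sub_scaled q (b / a) p)
     else (sub_scaled p (a / b) q, b # q)))"

function cgcd_loop :: "complex list \<times> complex list \<Rightarrow> complex list \<times> complex list" where
  "cgcd_loop s = (if fst s \<noteq> [] \<and> snd s \<noteq> [] then cgcd_loop (cgcd_step s) else s)"
  by auto

text \<open>Every branch shortens exactly one of the two lists, by one entry, and keeps the
  other.\<close>

lemma cgcd_step_decreasing:
  "fst s \<noteq> [] \<and> snd s \<noteq> [] \<Longrightarrow>
    length (fst (cgcd_step s)) + length (snd (cgcd_step s)) < length (fst s) + length (snd s)"
  unfolding cgcd_step_def by (auto split: list.split)

termination cgcd_loop
  by (relation "measure (\<lambda>s. length (fst s) + length (snd s))") (use cgcd_step_decreasing in auto)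

declare cgcd_loop.simps [simp del]

text \<open>When the loop stops, one of its two lists is empty, so appending them returns the
  other.\<close>

definition cgcd :: "complex list \<Rightarrow> complex list \<Rightarrow> complex list" where
  "cgcd p q = fst (cgcd_loop (p, q)) @ snd (cgcd_loop (p, q))"

lemma computable_cgcd [computable_intros]:
  assumes "computable b f" and "computable b g"
  shows "computable b (\<lambda>R x. cgcd (f R x) (g R x))"
proof -
  have "computable b (\<lambda>R. cgcd_loop)"
  proof (rule computable_while[where m = "\<lambda>R s. length (fst s) + length (snd s)" and g = "\<lambda>R. cgcd_step"
      and c = "\<lambda>R s. fst s \<noteq> [] \<and> snd s \<noteq> []"])
    show "computable b (\<lambda>R. cgcd_step)"
      unfolding cgcd_step_def[abs_def] by (intro computable_intros)
    show "computable b (\<lambda>R (s :: complex list \<times> complex list). fst s \<noteq> [] \<and> snd s \<noteq> [])"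
      by (intro computable_intros)
  qed (rule cgcd_step_decreasing, assumption, rule cgcd_loop.simps)
  note * = computable_comp[OF computable_Pair[OF assms] this]
  show ?thesis unfolding cgcd_def by (intro computable_intros *)
qed

text \<open>The empty list stands for the zero polynomial, which is neutral for greatest common
  divisors. For \<open>v \<noteq> 0\<close>, terms on a common coset contribute the same slice up to
  a unit, so cosets need not be kept apart.\<close>

definition line_gcd :: "terms \<Rightarrow> int \<times> int \<Rightarrow> complex list" where
  "line_gcd ts v = foldr (\<lambda>t d. cgcd (slice ts v (fst t)) d) ts []"

lemma computable_line_gcd [computable_intros]:
  assumes "computable b f" and "computable b g"
  shows "computable b (\<lambda>R x. line_gcd (f R x) (g R x))"
  by (rule computable_comp2[OF _ assms], unfold line_gcd_def) (intro computable_intros)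

section \<open>Selection and output of the factors\<close>

definition proper :: "complex list \<Rightarrow> bool" where
  "proper cs = (case filter (\<lambda>c. c \<noteq> 0) cs of [] \<Rightarrow> False | c # ds \<Rightarrow> ds \<noteq> [])"

lemma computable_proper [computable_intros]:
  assumes "computable b f"
  shows "computable b (\<lambda>R x. proper (f R x))"
  by (rule computable_comp[OF assms], unfold proper_def) (intro computable_intros)

definition line_factors :: "terms \<Rightarrow> ((int \<times> int) \<times> complex list) list" where
  "line_factors ts = filter (\<lambda>p. proper (snd p)) (map (\<lambda>v. (v, line_gcd ts v)) (directions ts))"

lemma computable_line_factors [computable_intros]:
  assumes "computable b f"
  shows "computable b (\<lambda>R x. line_factors (f R x))"
  by (rule computable_comp[OF assms], unfold line_factors_def) (intro computable_intros)

text \<open>Horner's scheme in \<open>X^v\<close>: an entry is placed at exponent \<open>0\<close>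
  and everything behind it is shifted by \<open>v\<close>.\<close>

definition embed :: "int \<times> int \<Rightarrow> complex list \<Rightarrow> terms" where
  "embed v cs = foldr (\<lambda>c ts. ((0, 0), c) #
     map (\<lambda>t. ((fst (fst t) + fst v, snd (fst t) + snd v), snd t)) ts) cs []"

lemma computable_embed [computable_intros]:
  assumes "computable b f" and "computable b g"
  shows "computable b (\<lambda>R x. embed (f R x) (g R x))"
  by (rule computable_comp2[OF _ assms], unfold embed_def) (intro computable_intros)

text \<open>Every line polynomial divides the zero polynomial, so in that case the answer is
  \<open>[[]]\<close>, which presents the single polynomial \<open>0\<close>. The test inspects
  coefficients because a nonempty list of terms may sum to zero.\<close>

definition maximal_factors :: "terms \<Rightarrow> terms list" where
  "maximal_factors ts = (if filter (\<lambda>t. coef ts (fst t) \<noteq> 0) ts = [] then [[]]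
     else map (\<lambda>p. embed (fst p) (snd p)) (line_factors ts))"

lemma computable_maximal_factors: "computable b (\<lambda>R. maximal_factors)"
  unfolding maximal_factors_def[abs_def] by (intro computable_intros)

text \<open>Coefficients of the product of all \<open>X - r\<close>: a \<open>0\<close> in front
  multiplies by \<open>X\<close>, and then \<open>r\<close> times the old list is
  subtracted.\<close>

definition prod_roots :: "complex list \<Rightarrow> complex list" where
  "prod_roots rs = foldr (\<lambda>r cs. sub_scaled (0 # cs) r cs) rs [1]"

lemma computable_prod_roots [computable_intros]:
  assumes "computable b f"
  shows "computable b (\<lambda>R x. prod_roots (f R x))"
  by (rule computable_comp[OF assms], unfold prod_roots_def) (intro computable_intros)

lemma computable_subseqs [computable_intros]:
  fixes f :: "_ \<Rightarrow> _ \<Rightarrow> 'c::encodable list"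
  assumes "computable b f"
  shows "computable b (\<lambda>R x. subseqs (f R x))"
proof -
  have "subseqs xs = foldr (\<lambda>x xss. map (\<lambda>ys. x # ys) xss @ xss) xs [[]]" for xs :: "'c list"
    by (induction xs) (simp_all add: Let_def)
  then show ?thesis by (simp only:) (rule computable_comp[OF assms], intro computable_intros)
qed

text \<open>Subsequences instead of subsets respect the multiplicities of roots. A root
  \<open>0\<close> only contributes the unit \<open>X^v\<close>, and the empty product is not a line
  polynomial.\<close>

definition all_factors :: "(complex list \<Rightarrow> complex list) \<Rightarrow> terms \<Rightarrow> terms list" where
  "all_factors R ts = concat (map (\<lambda>p. map (\<lambda>rs. embed (fst p) (prod_roots rs))
     (filter (\<lambda>rs. rs \<noteq> []) (subseqs (filter (\<lambda>r. r \<noteq> 0) (R (snd p)))))) (line_factors ts))"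

lemma computable_all_factors: "computable False all_factors"
  unfolding all_factors_def[abs_def] by (intro computable_intros computable_roots)

section \<open>Laurent polynomials supported on lines\<close>

text \<open>Makes the exponents an ordered group under the lexicographic order. The Laurent
  polynomials then have no zero divisors, which later permits the cancellation of linear
  factors.\<close>

instance prod :: (linordered_ab_group_add, linordered_ab_group_add) ordered_cancel_comm_monoid_add
  by standard (auto simp: less_eq_prod_def)

abbreviation supp :: "laurent \<Rightarrow> (int \<times> int) set" where
  "supp \<equiv> Poly_Mapping.keys"

abbreviation monomial :: "int \<times> int \<Rightarrow> complex \<Rightarrow> laurent" where
  "monomial \<equiv> Poly_Mapping.single"

section \<open>Restriction of the support\<close>

definition restr :: "(int \<times> int) set \<Rightarrow> laurent \<Rightarrow> laurent" where
  "restr S f = Poly_Mapping.mapp (\<lambda>u c. c when u \<in> S) f"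

lemma lookup_restr: "Poly_Mapping.lookup (restr S f) u = (Poly_Mapping.lookup f u when u \<in> S)"
  unfolding restr_def by (simp add: lookup_mapp in_keys_iff when_def)

lemma supp_restr [simp]: "supp (restr S f) = supp f \<inter> S"
  by (auto simp: in_keys_iff lookup_restr)

lemma restr_add: "restr S (f + g) = restr S f + restr S g"
  by (rule poly_mapping_eqI) (simp add: lookup_restr lookup_add when_add_distrib)

lemma restr_id: "supp f \<subseteq> S \<Longrightarrow> restr S f = f"
  by (rule poly_mapping_eqI) (auto simp: lookup_restr when_def in_keys_iff)

lemma restr_disjoint: "supp f \<inter> S = {} \<Longrightarrow> restr S f = 0"
  by (rule poly_mapping_eqI) (auto simp: lookup_restr when_def in_keys_iff)

lemma restr_split: "f = restr S f + restr (- S) f"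
  by (rule poly_mapping_eqI) (simp add: lookup_restr lookup_add when_def)

section \<open>Exponents of products\<close>

lemma supp_mult: "supp (f * g) \<subseteq> {a + b | a b. a \<in> supp f \<and> b \<in> supp g}"
  by (rule keys_mult)

text \<open>No cancellation happens at an exponent that decomposes in only one way: once the terms
  at \<open>A\<close> and \<open>B\<close> are split off, the remaining products cannot reach
  \<open>A + B\<close>.\<close>

lemma lookup_mult_unique:
  fixes f g :: laurent
  assumes "\<And>a b. a \<in> supp f \<Longrightarrow> b \<in> supp g \<Longrightarrow> a + b = A + B \<Longrightarrow> a = A \<and> b = B"
  shows "Poly_Mapping.lookup (f * g) (A + B) = Poly_Mapping.lookup f A * Poly_Mapping.lookup g B"
proof -
  let ?a = "monomial A (Poly_Mapping.lookup f A)" and ?b = "monomial B (Poly_Mapping.lookup g B)"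
  define f' g' where "f' = f - ?a" and "g' = g - ?b"
  have f': "supp f' = supp f - {A}" and g': "supp g' = supp g - {B}"
    by (auto simp: f'_def g'_def in_keys_iff lookup_minus lookup_single when_def split: if_splits)
  have "f * g = ?a * ?b + (?a * g' + f' * g)"
    by (simp add: f'_def g'_def algebra_simps)
  moreover have "A + B \<notin> supp (?a * g')"
  proof
    assume "A + B \<in> supp (?a * g')"
    then obtain a b where ab: "a \<in> supp ?a" "b \<in> supp g'" "A + B = a + b"
      using supp_mult[of ?a g'] by blast
    moreover from ab(1) have "a = A" by (simp split: if_splits)
    ultimately show False using g' by simp
  qed
  moreover have "A + B \<notin> supp (f' * g)"
  proof
    assume "A + B \<in> supp (f' * g)"
    then obtain a b where "a \<in> supp f'" "b \<in> supp g" "A + B = a + b"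
      using supp_mult[of f' g] by blast
    then show False using assms[of a b] f' by simp
  qed
  ultimately show ?thesis by (simp add: lookup_add mult_single in_keys_iff)
qed

lemma lex_add_eq:
  fixes a b A B :: "int \<times> int"
  assumes "a \<le> A" and "b \<le> B" and "a + b = A + B"
  shows "a = A \<and> b = B"
  using assms by (cases a; cases b; cases A; cases B) (simp, linarith)

text \<open>The lexicographically largest and smallest exponents of a product cannot cancel.\<close>

lemma two_le_card_supp_mult:
  fixes h q :: laurent
  assumes h: "2 \<le> card (supp h)" and q: "q \<noteq> 0"
  shows "2 \<le> card (supp (h * q))"
proof -
  let ?M = "Max (supp h) + Max (supp q)" and ?m = "Min (supp h) + Min (supp q)"
  have ne: "supp h \<noteq> {}" "supp q \<noteq> {}" using h q by auto
  have "a = Max (supp h) \<and> b = Max (supp q)"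
    if "a \<in> supp h" "b \<in> supp q" "a + b = ?M" for a b
    using that by (intro lex_add_eq) simp_all
  then have "Poly_Mapping.lookup (h * q) ?M \<noteq> 0"
    using Max_in[OF finite_keys ne(1)] Max_in[OF finite_keys ne(2)]
    by (subst lookup_mult_unique) (blast, simp add: in_keys_iff)
  moreover have "a = Min (supp h) \<and> b = Min (supp q)"
    if "a \<in> supp h" "b \<in> supp q" "a + b = ?m" for a b
    using that lex_add_eq[of "Min (supp h)" a "Min (supp q)" b] by simp
  then have "Poly_Mapping.lookup (h * q) ?m \<noteq> 0"
    using Min_in[OF finite_keys ne(1)] Min_in[OF finite_keys ne(2)]
    by (subst lookup_mult_unique) (blast, simp add: in_keys_iff)
  ultimately have sub: "{?M, ?m} \<subseteq> supp (h * q)" by (simp add: in_keys_iff)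
  obtain x y where xy: "x \<in> supp h" "y \<in> supp h" "x \<noteq> y"
    using h by (metis card_le_Suc0_iff_eq finite_keys not_less_eq_eq numeral_2_eq_2)
  have "?m \<noteq> ?M"
  proof
    assume "?m = ?M"
    moreover have "Min (supp h) \<le> Max (supp h)" "Min (supp q) \<le> Max (supp q)"
      using ne by simp_all
    ultimately have "Min (supp h) = Max (supp h)" using lex_add_eq by blast
    then have "z = Max (supp h)" if "z \<in> supp h" for z
      using that Min_le[of "supp h" z] Max_ge[of "supp h" z] by (intro order.antisym) simp_all
    with xy show False by metis
  qed
  with sub show ?thesis
    using card_mono[OF finite_keys sub] by simp
qed

lemma two_le_card_supp_dvd:
  fixes h f :: laurent
  assumes "2 \<le> card (supp h)" and "h dvd f" and "f \<noteq> 0"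
  shows "2 \<le> card (supp f)"
  using assms two_le_card_supp_mult by (metis dvdE mult_zero_right)

lemma not_dvd_monomial:
  assumes "2 \<le> card (supp h)" and "c \<noteq> 0"
  shows "\<not> h dvd monomial u c"
proof
  assume "h dvd monomial u c"
  moreover have "supp (monomial u c) = {u}" using assms(2) by simp
  moreover from this have "monomial u c \<noteq> 0" by force
  ultimately show False using two_le_card_supp_dvd[OF assms(1)] by fastforce
qed

lemma monomial_inverse: "monomial u 1 * monomial (- u) 1 = 1"
  by (simp add: mult_single flip: single_one)

lemma dvd_monomial_mult [simp]: "h dvd monomial u 1 * f \<longleftrightarrow> h dvd f"
proof
  assume "h dvd monomial u 1 * f"
  then have "h dvd monomial (- u) 1 * (monomial u 1 * f)" by (rule dvd_mult)
  also have "monomial (- u) 1 * (monomial u 1 * f) = (monomial u 1 * monomial (- u) 1) * f" by (simp only: ac_simps)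
  finally show "h dvd f" by (simp add: monomial_inverse)
qed (rule dvd_mult)

lemma lookup_monomial_mult:
  "Poly_Mapping.lookup (monomial a c * f) u = c * Poly_Mapping.lookup f (u - a)"
proof -
  have "Poly_Mapping.lookup (monomial a c * f) (a + (u - a)) =
      Poly_Mapping.lookup (monomial a c) a * Poly_Mapping.lookup f (u - a)"
    by (rule lookup_mult_unique) (auto split: if_splits)
  then show ?thesis by simp
qed

section \<open>Lines in the lattice of exponents\<close>

definition scale :: "int \<Rightarrow> int \<times> int \<Rightarrow> int \<times> int" where
  "scale k v = (k * fst v, k * snd v)"

lemma scale_simps [simp]:
  "scale 0 v = 0" "scale 1 v = v" "fst (scale k v) = k * fst v" "snd (scale k v) = k * snd v"
  by (simp_all add: scale_def prod_eq_iff)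

lemma scale_add: "scale (k + l) v = scale k v + scale l v"
  by (simp add: prod_eq_iff algebra_simps)

lemma scale_minus: "scale (- k) v = - scale k v"
  by (simp add: prod_eq_iff)

lemma scale_diff: "scale (k - l) v = scale k v - scale l v"
  by (simp add: prod_eq_iff algebra_simps)

lemma scale_scale: "scale k (scale l v) = scale (k * l) v"
  by (simp add: prod_eq_iff)

lemma scale_eq_0_iff: "scale k v = 0 \<longleftrightarrow> k = 0 \<or> v = 0"
  by (auto simp: prod_eq_iff)

lemma mem_lattice_line: "w \<in> lattice_line u v \<longleftrightarrow> (\<exists>k. w = u + scale k v)"
  by (auto simp: lattice_line_def scale_def)

lemma lattice_line_self: "u \<in> lattice_line u v"
  unfolding mem_lattice_line by (rule exI[of _ 0]) simp

lemma lattice_line_add: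
  assumes "a \<in> lattice_line u v" and "b \<in> lattice_line w v"
  shows "a + b \<in> lattice_line (u + w) v"
proof -
  from assms obtain k l where "a = u + scale k v" "b = w + scale l v"
    unfolding mem_lattice_line by blast
  then have "a + b = u + w + scale (k + l) v" by (simp add: scale_add)
  then show ?thesis unfolding mem_lattice_line by blast
qed

lemma lattice_line_minus:
  assumes "a \<in> lattice_line u v"
  shows "- a \<in> lattice_line (- u) v"
proof -
  from assms obtain k where "a = u + scale k v" unfolding mem_lattice_line by blast
  then have "- a = - u + scale (- k) v" by (simp add: scale_minus)
  then show ?thesis unfolding mem_lattice_line by blast
qed

lemma lattice_line_cong:
  assumes "w \<in> lattice_line u v"
  shows "lattice_line w v = lattice_line u v"
proof -
  have *: "lattice_line b v \<subseteq> lattice_line a v" if "b \<in> lattice_line a v" for a b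
  proof
    fix c assume "c \<in> lattice_line b v"
    then obtain k where "c = b + scale k v" unfolding mem_lattice_line by blast
    moreover have "scale k v \<in> lattice_line 0 v" unfolding mem_lattice_line by auto
    ultimately show "c \<in> lattice_line a v" using lattice_line_add[OF that] by fastforce
  qed
  have "u \<in> lattice_line w v"
  proof -
    from assms obtain k where "w = u + scale k v" unfolding mem_lattice_line by blast
    then have "u = w + scale (- k) v" by (simp add: scale_minus)
    then show ?thesis unfolding mem_lattice_line by blast
  qed
  with * assms show ?thesis by blast
qed

section \<open>Divisibility along a direction\<close>

lemma supp_mult_line:
  assumes "supp p \<subseteq> lattice_line a v" and "supp q \<subseteq> lattice_line b v"
  shows "supp (p * q) \<subseteq> lattice_line (a + b) v"
  using supp_mult[of p q] assms lattice_line_add by blast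

text \<open>Split \<open>q\<close> into its parts on and off the coset of \<open>u\<close>.
  Multiplication by \<open>p\<close> moves the first part into the coset of \<open>a + u\<close> and
  the second part away from it.\<close>

lemma restr_mult:
  assumes "supp p \<subseteq> lattice_line a v"
  shows "restr (lattice_line (a + u) v) (p * q) = p * restr (lattice_line u v) q"
proof -
  let ?S = "lattice_line u v" and ?T = "lattice_line (a + u) v"
  have "supp (p * restr ?S q) \<subseteq> ?T" using assms by (intro supp_mult_line) auto
  moreover have "supp (p * restr (- ?S) q) \<inter> ?T = {}"
  proof (rule ccontr)
    assume "supp (p * restr (- ?S) q) \<inter> ?T \<noteq> {}"
    then obtain x y where xy: "x \<in> supp p" "y \<notin> ?S" "x + y \<in> ?T"
      using supp_mult[of p "restr (- ?S) q"] unfolding supp_restr by blast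
    have "- x \<in> lattice_line (- a) v" using xy(1) assms lattice_line_minus by blast
    from lattice_line_add[OF this xy(3)] have "y \<in> ?S" by simp
    with xy(2) show False by simp
  qed
  ultimately have "restr ?T (p * restr ?S q + p * restr (- ?S) q) = p * restr ?S q"
    by (simp add: restr_add restr_id restr_disjoint)
  then show ?thesis by (simp flip: distrib_left restr_split)
qed

text \<open>Any cofactor can be replaced by its restriction to the coset of \<open>b - a\<close>,
  because restricting \<open>f\<close> to its own line changes nothing.\<close>

lemma dvd_line_cofactor:
  assumes "supp p \<subseteq> lattice_line a v" and "supp f \<subseteq> lattice_line b v" and "p dvd f"
  obtains q where "supp q \<subseteq> lattice_line (b - a) v" and "f = p * q"
proof -
  obtain q where "f = p * q" using assms(3) by (rule dvdE)
  then have "f = p * restr (lattice_line (b - a) v) q"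
    using restr_mult[OF assms(1), of "b - a" q] assms(2) by (simp add: restr_id)
  then show ?thesis by (rule that[rotated]) simp
qed

text \<open>The cosets partition the support, so \<open>f\<close> is the sum of its fibres. The
  induction removes one fibre at a time; the fibres of the remainder are still fibres of
  \<open>f\<close>.\<close>

lemma dvd_if_dvd_fibres:
  assumes "\<And>u. u \<in> supp f \<Longrightarrow> h dvd restr (lattice_line u v) f"
  shows "h dvd f"
  using assms
proof (induction "card (supp f)" arbitrary: f rule: less_induct)
  case less
  show ?case
  proof (cases "f = 0")
    case False
    then obtain u where u: "u \<in> supp f" by (metis all_not_in_conv keys_eq_empty)
    let ?S = "lattice_line u v"
    have "h dvd restr (- ?S) f"
    proof (rule less.hyps)
      show "card (supp (restr (- ?S) f)) < card (supp f)"
        using u lattice_line_self[of u v] by (intro psubset_card_mono) auto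
      fix w assume w: "w \<in> supp (restr (- ?S) f)"
      have "lattice_line w v \<inter> ?S = {}"
      proof (rule ccontr)
        assume "lattice_line w v \<inter> ?S \<noteq> {}"
        then obtain x where "x \<in> lattice_line w v" "x \<in> ?S" by blast
        then have "lattice_line w v = ?S" using lattice_line_cong by metis
        then show False using w lattice_line_self[of w v] by simp
      qed
      then have "restr (lattice_line w v) (restr (- ?S) f) = restr (lattice_line w v) f"
        by (intro poly_mapping_eqI) (auto simp: lookup_restr when_def)
      then show "h dvd restr (lattice_line w v) (restr (- ?S) f)"
        using less.prems[of w] w by simp
    qed
    with less.prems[OF u] show ?thesis by (subst restr_split[of f ?S]) (rule dvd_add)
  qed simp
qed

text \<open>Restricting \<open>f = h * q\<close> to a coset amounts to restricting \<open>q\<close>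
  to the coset shifted by \<open>- a\<close>.\<close>

lemma line_dvd_fibre:
  assumes "supp h \<subseteq> lattice_line a v" and "h dvd f"
  shows "h dvd restr (lattice_line u v) f"
proof -
  obtain q where "f = h * q" using assms(2) by (rule dvdE)
  then show ?thesis using restr_mult[OF assms(1), of "u - a" q] by simp
qed

section \<open>Correctness\<close>

lemma laurent_of_Nil [simp]: "laurent_of [] = 0"
  by (simp add: laurent_of_def)

lemma laurent_of_Cons [simp]: "laurent_of (t # ts) = monomial (fst t) (snd t) + laurent_of ts"
  by (simp add: laurent_of_def case_prod_beta)

lemma coef_eq_lookup: "coef ts u = Poly_Mapping.lookup (laurent_of ts) u"
  unfolding coef_def
  by (induction ts) (auto simp: lookup_add lookup_single when_def prod_eq_iff)

text \<open>Only an inclusion, since terms may cancel or have coefficient zero.\<close>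

lemma supp_laurent_of: "supp (laurent_of ts) \<subseteq> fst ` set ts"
proof (induction ts)
  case (Cons t ts)
  then show ?case
    using keys_add[of "monomial (fst t) (snd t)" "laurent_of ts"] by (auto split: if_splits)
qed simp

section \<open>Bounds for the finite searches\<close>

lemma radius_Cons:
  "radius (t # ts) = 2 * (\<bar>fst (fst t)\<bar> + \<bar>snd (fst t)\<bar>) + radius ts"
  by (simp add: radius_def)

lemma radius_nonneg: "0 \<le> radius ts"
  by (induction ts) (simp_all add: radius_Cons, simp add: radius_def)

lemma radius_bound:
  assumes "u \<in> fst ` set ts"
  shows "2 * \<bar>fst u\<bar> \<le> radius ts" and "2 * \<bar>snd u\<bar> \<le> radius ts"
proof -
  have "2 * \<bar>fst u\<bar> \<le> radius ts \<and> 2 * \<bar>snd u\<bar> \<le> radius ts"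
    using assms
  proof (induction ts)
    case (Cons t ts)
    then show ?case using radius_nonneg[of ts] by (cases "u = fst t") (auto simp: radius_Cons)
  qed simp
  then show "2 * \<bar>fst u\<bar> \<le> radius ts" and "2 * \<bar>snd u\<bar> \<le> radius ts" by simp_all
qed

text \<open>The triangle inequality; the factor \<open>2\<close> in \<open>radius\<close> pays for
  its two summands.\<close>

lemma radius_diff_bound:
  assumes "u \<in> fst ` set ts" and "u + w \<in> fst ` set ts"
  shows "\<bar>fst w\<bar> \<le> radius ts" and "\<bar>snd w\<bar> \<le> radius ts"
proof -
  have "\<bar>j\<bar> \<le> n" if "2 * \<bar>i\<bar> \<le> n" "2 * \<bar>i + j\<bar> \<le> n" for i j n :: int
    using that by (auto simp: abs_if split: if_splits)
  with radius_bound[OF assms(1)] radius_bound[OF assms(2)]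
  show "\<bar>fst w\<bar> \<le> radius ts" and "\<bar>snd w\<bar> \<le> radius ts" by simp_all
qed

lemma mult_bound:
  fixes i k n :: int
  assumes "k \<noteq> 0" and "\<bar>k * i\<bar> \<le> n"
  shows "\<bar>i\<bar> \<le> n"
proof -
  have "1 * \<bar>i\<bar> \<le> \<bar>k\<bar> * \<bar>i\<bar>" using assms(1) by (intro mult_right_mono) simp_all
  with assms(2) show ?thesis by (simp add: abs_mult)
qed

text \<open>Justifies both finite searches: the bounds on \<open>v\<close> concern the box of
  candidate directions, the bound on \<open>k\<close> the window of a slice.\<close>

lemma scale_radius_bound:
  assumes "u \<in> fst ` set ts" and "u + scale k v \<in> fst ` set ts"
  shows "k \<noteq> 0 \<Longrightarrow> \<bar>fst v\<bar> \<le> radius ts" and "k \<noteq> 0 \<Longrightarrow> \<bar>snd v\<bar> \<le> radius ts"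
    and "v \<noteq> 0 \<Longrightarrow> \<bar>k\<bar> \<le> radius ts"
proof -
  note b = radius_diff_bound[OF assms]
  show "k \<noteq> 0 \<Longrightarrow> \<bar>fst v\<bar> \<le> radius ts" "k \<noteq> 0 \<Longrightarrow> \<bar>snd v\<bar> \<le> radius ts"
    using b mult_bound[of k] by simp_all
  assume "v \<noteq> 0"
  then have "fst v \<noteq> 0 \<or> snd v \<noteq> 0" by (simp add: prod_eq_iff)
  then show "\<bar>k\<bar> \<le> radius ts"
    using b mult_bound[of "fst v" k] mult_bound[of "snd v" k] by (auto simp: mult.commute)
qed

text \<open>The univariate polynomial with coefficient list \<open>cs\<close>, constant term first,
  evaluated at \<open>X^v\<close>.\<close>

definition line_poly :: "int \<times> int \<Rightarrow> complex list \<Rightarrow> laurent" where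
  "line_poly v cs = foldr (\<lambda>c g. monomial 0 c + monomial v 1 * g) cs 0"

lemma line_poly_simps [simp]:
  "line_poly v [] = 0"
  "line_poly v (c # cs) = monomial 0 c + monomial v 1 * line_poly v cs"
  by (simp_all add: line_poly_def)

lemma laurent_of_embed: "laurent_of (embed v cs) = line_poly v cs"
proof (induction cs)
  case (Cons c cs)
  have shift: "laurent_of (map (\<lambda>t. ((fst (fst t) + fst v, snd (fst t) + snd v), snd t)) ts) =
      monomial v 1 * laurent_of ts" for ts
  proof (induction ts)
    case (Cons t ts)
    have "(fst (fst t) + fst v, snd (fst t) + snd v) = v + fst t" by (simp add: prod_eq_iff)
    with Cons show ?case by (simp add: distrib_left mult_single)
  qed simp
  have "embed v (c # cs) = ((0, 0), c) #
      map (\<lambda>t. ((fst (fst t) + fst v, snd (fst t) + snd v), snd t)) (embed v cs)"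
    by (simp add: embed_def)
  then show ?case by (simp only: laurent_of_Cons shift Cons.IH) (simp add: zero_prod_def)
qed (simp add: embed_def)

lemma supp_line_poly: "supp (line_poly v cs) \<subseteq> lattice_line 0 v"
proof (induction cs)
  case (Cons c cs)
  have "v \<in> lattice_line 0 v" unfolding mem_lattice_line by (rule exI[of _ 1]) simp
  then have "supp (monomial v 1 :: laurent) \<subseteq> lattice_line 0 v" by simp
  from supp_mult_line[OF this Cons]
  show ?case
    using keys_add[of "monomial 0 c" "monomial v 1 * line_poly v cs"] lattice_line_self[of 0 v]
    by (auto split: if_splits)
qed simp

lemma lookup_line_poly:
  assumes "v \<noteq> 0"
  shows "Poly_Mapping.lookup (line_poly v cs) (scale k v) =
    (if 0 \<le> k \<and> k < int (length cs) then cs ! nat k else 0)"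
proof (induction cs arbitrary: k)
  case (Cons c cs)
  have "Poly_Mapping.lookup (line_poly v (c # cs)) (scale k v) =
      (c when k = 0) + Poly_Mapping.lookup (line_poly v cs) (scale (k - 1) v)"
    using assms
    by (simp add: lookup_add lookup_single lookup_monomial_mult scale_diff scale_eq_0_iff
        eq_commute[of 0 "scale k v"])
  also have "\<dots> = (if 0 \<le> k \<and> k < int (length (c # cs)) then (c # cs) ! nat k else 0)"
    unfolding Cons.IH by (auto simp: when_def nth_Cons' nat_diff_distrib)
  finally show ?case .
qed auto

lemma scale_inj: "v \<noteq> 0 \<Longrightarrow> scale k v = scale l v \<longleftrightarrow> k = l"
  using scale_eq_0_iff[of "k - l" v] by (simp add: scale_diff)

lemma card_supp_line_poly:
  assumes "v \<noteq> 0"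
  shows "card (supp (line_poly v cs)) = length (filter (\<lambda>c. c \<noteq> 0) cs)"
proof -
  let ?f = "\<lambda>k. scale (int k) v" and ?S = "{k. k < length cs \<and> cs ! k \<noteq> 0}"
  have "supp (line_poly v cs) = ?f ` ?S"
  proof (intro equalityI subsetI)
    fix w assume w: "w \<in> supp (line_poly v cs)"
    then obtain k where k: "w = scale k v"
      using supp_line_poly[of v cs] by (metis add_0 mem_lattice_line subsetD)
    with w lookup_line_poly[OF assms, of cs k]
    have "0 \<le> k \<and> nat k < length cs \<and> cs ! nat k \<noteq> 0" by (auto simp: in_keys_iff split: if_splits)
    then show "w \<in> ?f ` ?S" using k by (intro image_eqI[of _ _ "nat k"]) simp_all
  next
    fix w assume "w \<in> ?f ` ?S"
    then show "w \<in> supp (line_poly v cs)"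
      by (auto simp: in_keys_iff lookup_line_poly[OF assms])
  qed
  moreover have "inj_on ?f ?S" by (auto simp: inj_on_def scale_inj[OF assms])
  ultimately show ?thesis by (simp add: card_image length_filter_conv_card)
qed

lemma proper_iff: "proper cs \<longleftrightarrow> 2 \<le> length (filter (\<lambda>c. c \<noteq> 0) cs)"
proof (cases "filter (\<lambda>c. c \<noteq> 0) cs")
  case (Cons c ds)
  then show ?thesis by (cases ds) (simp_all add: proper_def)
qed (simp add: proper_def)

text \<open>A slice lists the fibre from index \<open>- radius ts\<close> on. The monomial, a unit,
  moves it back to its place.\<close>

lemma fibre_eq_slice:
  assumes "v \<noteq> 0" and "u \<in> fst ` set ts"
  shows "restr (lattice_line u v) (laurent_of ts) =
    monomial (u - scale (radius ts) v) 1 * line_poly v (slice ts v u)"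
    (is "?l = monomial ?a 1 * ?p")
proof (rule poly_mapping_eqI)
  fix w
  let ?N = "radius ts"
  have a: "lattice_line ?a v = lattice_line u v"
    by (rule lattice_line_cong) (auto simp: mem_lattice_line intro!: exI[of _ "- ?N"] simp: scale_minus)
  show "Poly_Mapping.lookup ?l w = Poly_Mapping.lookup (monomial ?a 1 * ?p) w"
  proof (cases "w \<in> lattice_line u v")
    case False
    have "supp (monomial ?a 1 :: laurent) \<subseteq> lattice_line ?a v" using lattice_line_self by simp
    from supp_mult_line[OF this supp_line_poly[of v "slice ts v u"]]
    have "w \<notin> supp (monomial ?a 1 * ?p)" using False a by auto
    moreover have "w \<notin> supp ?l" using False by simp
    ultimately show ?thesis by (simp only: in_keys_iff not_not)
  next
    case True
    then obtain k where k: "w = u + scale k v" unfolding mem_lattice_line by blast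
    have "Poly_Mapping.lookup (monomial ?a 1 * ?p) w = Poly_Mapping.lookup ?p (scale (k + ?N) v)"
      by (simp add: lookup_monomial_mult k scale_add)
    also have "\<dots> = Poly_Mapping.lookup (laurent_of ts) w"
    proof (cases "\<bar>k\<bar> \<le> ?N")
      case True
      then have k_nth: "window ts ! nat (k + ?N) = k"
        unfolding window_def by (subst nth_upto) auto
      have "nat (k + ?N) < length (window ts)" using True by (simp add: window_def)
      then have "slice ts v u ! nat (k + ?N) = coef ts (fst u + k * fst v, snd u + k * snd v)"
        unfolding slice_def by (simp only: nth_map k_nth)
      moreover have "length (slice ts v u) = nat (2 * ?N + 1)"
        by (simp add: slice_def window_def)
      ultimately have "Poly_Mapping.lookup ?p (scale (k + ?N) v) =
          coef ts (fst u + k * fst v, snd u + k * snd v)"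
        using True by (auto simp: lookup_line_poly[OF assms(1)] abs_le_iff)
      also have "(fst u + k * fst v, snd u + k * snd v) = w" by (simp add: k prod_eq_iff)
      finally show ?thesis by (simp only: coef_eq_lookup)
    next
      case False
      \<comment> \<open>Beyond the window \<open>k\<close> is too large for \<open>w\<close> to be a
        listed exponent, so truncation loses nothing.\<close>
      then have "w \<notin> supp (laurent_of ts)"
        using scale_radius_bound(3)[OF assms(2), of k v] supp_laurent_of[of ts] assms(1) k by blast
      then show ?thesis
        using False by (auto simp: lookup_line_poly[OF assms(1)] slice_def window_def in_keys_iff)
    qed
    finally show ?thesis using True by (simp add: lookup_restr)
  qed
qed

text \<open>The length hypothesis ensures that no entry of \<open>q\<close> is cut off.\<close>

lemma line_poly_sub_scaled:
  "length q \<le> length p \<Longrightarrow>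
    line_poly v (sub_scaled p c q) = line_poly v p - monomial 0 c * line_poly v q"
proof (induction p c q rule: sub_scaled.induct)
  case (3 a p c b q)
  then have "line_poly v p = line_poly v (sub_scaled p c q) + monomial 0 c * line_poly v q" by simp
  moreover have "monomial 0 (a - c * b) = monomial 0 a - monomial 0 c * monomial 0 b"
    by (simp add: single_diff mult_single)
  ultimately show ?case by (simp add: algebra_simps)
qed simp_all

section \<open>Common divisors under Euclid's algorithm\<close>

lemma dvd_diff_mult_iff:
  fixes h p q r :: laurent
  assumes "h dvd q"
  shows "h dvd p - r * q \<longleftrightarrow> h dvd p"
proof
  assume "h dvd p - r * q"
  then have "h dvd (p - r * q) + r * q" using assms by (intro dvd_add dvd_mult)
  then show "h dvd p" by simp
qed (use assms in \<open>intro dvd_diff dvd_mult\<close>)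

text \<open>
  Eliminating the constant terms and dropping a vanishing head divides by the unit \<open>X\<^sup>v\<close>, so
  Euclid's algorithm keeps the common divisors of the two Laurent polynomials.
\<close>

lemma cgcd_step_dvd:
  "h dvd line_poly v (fst (cgcd_step s)) \<and> h dvd line_poly v (snd (cgcd_step s)) \<longleftrightarrow>
   h dvd line_poly v (fst s) \<and> h dvd line_poly v (snd s)"
proof -
  have reduce: "h dvd line_poly v (sub_scaled p (a / b) q) \<longleftrightarrow> h dvd line_poly v (a # p)"
    if "b \<noteq> 0" "length q \<le> length p" "h dvd line_poly v (b # q)" for a b p q
  proof -
    \<comment> \<open>The quotient \<open>a / b\<close> makes the constant terms cancel, so the
      difference is \<open>X^v\<close> times the polynomial of the shortened list.\<close>
    have "monomial v 1 * line_poly v (sub_scaled p (a / b) q) =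
        line_poly v (a # p) - monomial 0 (a / b) * line_poly v (b # q)"
    proof -
      have "monomial 0 (a / b) * monomial 0 b = monomial 0 a"
        using that(1) by (simp add: mult_single)
      moreover have "line_poly v p = line_poly v (sub_scaled p (a / b) q) +
          monomial 0 (a / b) * line_poly v q"
        using line_poly_sub_scaled[OF that(2)] by simp
      ultimately show ?thesis by (simp add: algebra_simps)
    qed
    then have "h dvd line_poly v (sub_scaled p (a / b) q) \<longleftrightarrow>
        h dvd line_poly v (a # p) - monomial 0 (a / b) * line_poly v (b # q)"
      by (metis dvd_monomial_mult)
    with dvd_diff_mult_iff[OF that(3)] show ?thesis by blast
  qed
  show ?thesis
  proof (cases "fst s = [] \<or> snd s = []")
    case False
    then obtain a p b q where s: "s = (a # p, b # q)"
      by (metis list.exhaust prod.collapse)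
    consider "a = 0" | "a \<noteq> 0" "b = 0" | "a \<noteq> 0" "b \<noteq> 0" "length p < length q"
      | "a \<noteq> 0" "b \<noteq> 0" "length q \<le> length p" by linarith
    then show ?thesis
    proof cases
      case 3
      then have "cgcd_step s = (a # p, sub_scaled q (b / a) p)" by (simp add: s cgcd_step_def)
      with reduce[of a p q b] 3 show ?thesis by (simp only: s fst_conv snd_conv) auto
    next
      case 4
      then have "cgcd_step s = (sub_scaled p (a / b) q, b # q)" by (simp add: s cgcd_step_def)
      with reduce[of b q p a] 4 show ?thesis by (simp only: s fst_conv snd_conv) auto
    qed (simp_all add: s cgcd_step_def)
  qed (auto simp: cgcd_step_def split: list.split)
qed

lemma cgcd_dvd:
  "h dvd line_poly v (cgcd p q) \<longleftrightarrow> h dvd line_poly v p \<and> h dvd line_poly v q"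
proof -
  have "h dvd line_poly v (fst (cgcd_loop s) @ snd (cgcd_loop s)) \<longleftrightarrow>
      h dvd line_poly v (fst s) \<and> h dvd line_poly v (snd s)" for s
  proof (induction s rule: cgcd_loop.induct)
    case (1 s)
    show ?case
    proof (cases "fst s \<noteq> [] \<and> snd s \<noteq> []")
      case True
      then have "cgcd_loop s = cgcd_loop (cgcd_step s)" by (subst cgcd_loop.simps) simp
      with 1[OF True] cgcd_step_dvd show ?thesis by metis
    next
      case False
      then have "cgcd_loop s = s" by (subst cgcd_loop.simps) auto
      with False show ?thesis by auto
    qed
  qed
  from this[of "(p, q)"] show ?thesis by (simp add: cgcd_def)
qed

lemma line_gcd_dvd:
  "h dvd line_poly v (line_gcd ts v) \<longleftrightarrow> (\<forall>u \<in> fst ` set ts. h dvd line_poly v (slice ts v u))"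
proof -
  have "h dvd line_poly v (foldr (\<lambda>t d. cgcd (slice ts v (fst t)) d) ts' []) \<longleftrightarrow>
      (\<forall>u \<in> fst ` set ts'. h dvd line_poly v (slice ts v u))" for ts' :: terms
    by (induction ts') (simp_all add: cgcd_dvd)
  then show ?thesis unfolding line_gcd_def .
qed

text \<open>Dividing \<open>f\<close> means dividing all its fibres, the fibres through listed
  exponents are the slices up to units, and the divisors of the gcd are the common divisors of the
  slices.\<close>

lemma line_gcd_greatest:
  assumes "v \<noteq> 0" and "supp h \<subseteq> lattice_line a v"
  shows "h dvd line_poly v (line_gcd ts v) \<longleftrightarrow> h dvd laurent_of ts"
proof -
  let ?f = "laurent_of ts"
  have "h dvd line_poly v (slice ts v u) \<longleftrightarrow> h dvd restr (lattice_line u v) ?f"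
    if "u \<in> fst ` set ts" for u
    by (simp add: fibre_eq_slice[OF assms(1) that])
  then have "h dvd line_poly v (line_gcd ts v) \<longleftrightarrow>
      (\<forall>u \<in> fst ` set ts. h dvd restr (lattice_line u v) ?f)"
    unfolding line_gcd_dvd by (intro ball_cong refl)
  also have "\<dots> \<longleftrightarrow> h dvd ?f"
  proof
    assume *: "\<forall>u \<in> fst ` set ts. h dvd restr (lattice_line u v) ?f"
    show "h dvd ?f"
      by (rule dvd_if_dvd_fibres[of _ _ v]) (rule bspec[OF * subsetD[OF supp_laurent_of]])
  qed (intro ballI line_dvd_fibre[OF assms(2)])
  finally show ?thesis .
qed

lemma line_gcd_dvd_laurent_of:
  "v \<noteq> 0 \<Longrightarrow> line_poly v (line_gcd ts v) dvd laurent_of ts"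
  using line_gcd_greatest[OF _ supp_line_poly] dvd_refl by metis

section \<open>Directions and the list of line factors\<close>

lemma primitive_direction:
  assumes "v \<noteq> 0"
  obtains w k where "primitive w" and "v = scale k w"
proof
  let ?g = "gcd (fst v) (snd v)"
  let ?w = "(fst v div ?g, snd v div ?g)"
  show v: "v = scale ?g ?w" by (simp add: prod_eq_iff)
  have "fst v \<noteq> 0 \<or> snd v \<noteq> 0" using assms by (simp add: prod_eq_iff)
  then have "coprime (fst v div ?g) (snd v div ?g)" by (rule div_gcd_coprime)
  moreover have "?w \<noteq> 0" using assms v scale_eq_0_iff by metis
  ultimately show "primitive ?w" by (simp add: primitive_def)
qed

text \<open>Admits directions that are not primitive: a line of direction \<open>v\<close> is
  contained in the line of the primitive vector of which \<open>v\<close> is a multiple.\<close>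

lemma line_polynomialI:
  assumes "v \<noteq> 0" and "supp g \<subseteq> lattice_line u v" and "2 \<le> card (supp g)"
  shows "line_polynomial g"
proof -
  obtain w k where w: "primitive w" "v = scale k w" using assms(1) by (rule primitive_direction)
  have "lattice_line u v \<subseteq> lattice_line u w"
    unfolding w(2) by (auto simp: mem_lattice_line scale_scale)
  with assms w(1) show ?thesis unfolding line_polynomial_def by (metis order.trans)
qed

lemma mem_line_factors:
  "(v, d) \<in> set (line_factors ts) \<longleftrightarrow> v \<noteq> 0 \<and> \<bar>fst v\<bar> \<le> radius ts \<and> \<bar>snd v\<bar> \<le> radius ts \<and>
    d = line_gcd ts v \<and> 2 \<le> card (supp (line_poly v d))"
  unfolding line_factors_def directions_def window_def
  by (cases v) (auto simp: card_supp_line_poly proper_iff zero_prod_def image_iff)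

lemma line_factors_sound:
  assumes "(v, d) \<in> set (line_factors ts)"
  shows "v \<noteq> 0" and "line_polynomial (line_poly v d)" and "line_poly v d dvd laurent_of ts"
proof -
  from assms show "v \<noteq> 0" by (simp add: mem_line_factors)
  from this assms show "line_polynomial (line_poly v d)"
    by (intro line_polynomialI[OF _ supp_line_poly]) (auto simp: mem_line_factors)
  from assms show "line_poly v d dvd laurent_of ts"
    using line_gcd_dvd_laurent_of by (simp add: mem_line_factors)
qed

lemma line_factors_complete:
  assumes "laurent_of ts \<noteq> 0" and "line_polynomial h" and "h dvd laurent_of ts"
  obtains v d a where "(v, d) \<in> set (line_factors ts)" and "supp h \<subseteq> lattice_line a v"
    and "h dvd line_poly v d"
proof -
  let ?f = "laurent_of ts"
  obtain a v where v: "primitive v" "supp h \<subseteq> lattice_line a v" and h: "2 \<le> card (supp h)"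
    using assms(2) unfolding line_polynomial_def by metis
  have "v \<noteq> 0" using v(1) by (simp add: primitive_def)
  obtain u where u: "u \<in> supp ?f" using assms(1) by (metis all_not_in_conv keys_eq_empty)
  let ?r = "restr (lattice_line u v) ?f"
  have "u \<in> supp ?r" using u lattice_line_self by simp
  then have "?r \<noteq> 0" by (metis empty_iff keys_zero)
  \<comment> \<open>A nonzero fibre that is divisible by \<open>h\<close> has a second exponent. It
    differs from \<open>u\<close> by a nonzero multiple of \<open>v\<close>, which forces
    \<open>v\<close> into the searched box.\<close>
  then have "2 \<le> card (supp ?r)"
    using two_le_card_supp_dvd[OF h line_dvd_fibre[OF v(2) assms(3)]] by blast
  then obtain w where w: "w \<in> supp ?r" "w \<noteq> u"
    by (metis card_le_Suc0_iff_eq finite_keys not_less_eq_eq numeral_2_eq_2)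
  then obtain k where k: "w = u + scale k v" by (auto simp: mem_lattice_line)
  with w have "k \<noteq> 0" by auto
  have exps: "u \<in> fst ` set ts" "u + scale k v \<in> fst ` set ts"
    using u w k supp_laurent_of[of ts] by auto
  let ?d = "line_gcd ts v"
  have hd: "h dvd line_poly v ?d" using line_gcd_greatest[OF \<open>v \<noteq> 0\<close> v(2)] assms(3) by blast
  \<comment> \<open>Being nonzero and a multiple of \<open>h\<close>, the gcd has at least two
    exponents and so survives the filter \<open>proper\<close>.\<close>
  have "line_poly v ?d \<noteq> 0"
    using line_gcd_dvd_laurent_of[OF \<open>v \<noteq> 0\<close>] assms(1) by (metis dvd_0_left)
  then have "2 \<le> card (supp (line_poly v ?d))" by (rule two_le_card_supp_dvd[OF h hd])
  with scale_radius_bound(1,2)[OF exps \<open>k \<noteq> 0\<close>] \<open>v \<noteq> 0\<close>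
  have "(v, ?d) \<in> set (line_factors ts)" by (simp add: mem_line_factors)
  from this v(2) hd show ?thesis by (rule that)
qed

section \<open>Splitting a line polynomial into linear factors\<close>

abbreviation lin :: "int \<times> int \<Rightarrow> complex \<Rightarrow> laurent" where
  "lin v r \<equiv> monomial v 1 - monomial 0 r"

definition lin_prod :: "int \<times> int \<Rightarrow> complex list \<Rightarrow> laurent" where
  "lin_prod v rs = (\<Prod>r\<leftarrow>rs. lin v r)"

lemma lin_prod_simps [simp]:
  "lin_prod v [] = 1" "lin_prod v (r # rs) = lin v r * lin_prod v rs"
  by (simp_all add: lin_prod_def)

lemma supp_lin: "supp (lin v r) \<subseteq> lattice_line 0 v"
proof -
  have "lin v r = line_poly v [- r, 1]" by (simp add: single_uminus)
  then show ?thesis by (simp only: supp_line_poly)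
qed

lemma card_supp_lin: "v \<noteq> 0 \<Longrightarrow> r \<noteq> 0 \<Longrightarrow> card (supp (lin v r)) = 2"
  using card_supp_line_poly[of v "[- r, 1]"] by (simp add: single_uminus)

lemma lin_nonzero: "v \<noteq> 0 \<Longrightarrow> r \<noteq> 0 \<Longrightarrow> lin v r \<noteq> 0"
  using card_supp_lin[of v r] by force

lemma line_poly_prod_roots: "line_poly v (prod_roots rs) = lin_prod v rs"
proof (induction rs)
  case (Cons r rs)
  have "prod_roots (r # rs) = sub_scaled (0 # prod_roots rs) r (prod_roots rs)"
    by (simp add: prod_roots_def)
  then show ?case by (simp add: line_poly_sub_scaled Cons algebra_simps)
qed (simp add: prod_roots_def)

lemma supp_lin_prod: "supp (lin_prod v rs) \<subseteq> lattice_line 0 v"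
  unfolding line_poly_prod_roots[symmetric] by (rule supp_line_poly)

text \<open>Substitution of \<open>X^v\<close> for the variable; it carries the factorisation
  supplied by \<open>root_finder\<close> over to Laurent polynomials.\<close>

definition line_map :: "int \<times> int \<Rightarrow> complex poly \<Rightarrow> laurent" where
  "line_map v p = poly (map_poly (monomial 0) p) (monomial v 1)"

lemma line_map_pCons: "line_map v (pCons c p) = monomial 0 c + monomial v 1 * line_map v p"
  unfolding line_map_def by (simp add: map_poly_pCons)

lemma line_map_0 [simp]: "line_map v 0 = 0"
  by (simp add: line_map_def)

lemma line_map_Poly: "line_map v (Poly cs) = line_poly v cs"
  by (induction cs) (simp_all add: line_map_pCons)

lemma line_map_smult: "line_map v (smult c p) = monomial 0 c * line_map v p"
  by (induction p) (simp_all add: line_map_pCons algebra_simps mult_single)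

lemma line_map_add: "line_map v (p + q) = line_map v p + line_map v q"
  by (induction p q rule: poly_induct2) (simp_all add: line_map_pCons algebra_simps single_add)

lemma line_map_prod: "line_map v (\<Prod>r\<leftarrow>rs. [:- r, 1:]) = lin_prod v rs"
proof (induction rs)
  case Nil
  then show ?case using line_map_pCons[of v 1 0] by (simp add: one_pCons)
next
  case (Cons r rs)
  have "[:- r, 1:] * p = smult (- r) p + pCons 0 p" for p by simp
  then have "line_map v ([:- r, 1:] * p) = lin v r * line_map v p" for p
    by (simp only: line_map_add line_map_smult line_map_pCons)
      (simp add: single_uminus algebra_simps)
  with Cons show ?case by simp
qed

text \<open>The two polynomials differ by units only: the leading coefficient, and one factor
  \<open>X^v\<close> for each root \<open>0\<close>.\<close>

lemma line_poly_dvd_lin_prod: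
  assumes "root_finder R" and "line_poly v d \<noteq> 0"
  shows "h dvd line_poly v d \<longleftrightarrow> h dvd lin_prod v (filter (\<lambda>r. r \<noteq> 0) (R d))"
proof -
  let ?l = "lead_coeff (Poly d)"
  have "Poly d \<noteq> 0" using assms(2) by (metis line_map_0 line_map_Poly)
  then have "Poly d = smult ?l (\<Prod>r\<leftarrow>R d. [:- r, 1:])" and l: "?l \<noteq> 0"
    using assms(1) unfolding root_finder_def by auto
  then have eq: "line_poly v d = monomial 0 ?l * lin_prod v (R d)"
    by (metis line_map_Poly line_map_smult line_map_prod)
  have "monomial 0 (1 / ?l) * line_poly v d = lin_prod v (R d)"
    using l by (simp add: eq mult.assoc[symmetric] mult_single)
  with eq have "h dvd line_poly v d \<longleftrightarrow> h dvd lin_prod v (R d)" by (metis dvd_mult)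
  also have "\<exists>a. lin_prod v rs = monomial a 1 * lin_prod v (filter (\<lambda>r. r \<noteq> 0) rs)" for rs
  proof (induction rs)
    case Nil
    show ?case by (intro exI[of _ 0]) simp
  next
    case (Cons r rs)
    then obtain a where a: "lin_prod v rs = monomial a 1 * lin_prod v (filter (\<lambda>r. r \<noteq> 0) rs)"
      by blast
    show ?case
    proof (cases "r = 0")
      case True
      then have "lin_prod v (r # rs) = monomial (v + a) 1 * lin_prod v (filter (\<lambda>r. r \<noteq> 0) (r # rs))"
        by (simp add: a mult.assoc[symmetric] mult_single)
      then show ?thesis by blast
    next
      case False
      then have "lin_prod v (r # rs) = monomial a 1 * lin_prod v (filter (\<lambda>r. r \<noteq> 0) (r # rs))"
        by (simp add: a algebra_simps)
      then show ?thesis by blast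
    qed
  qed
  then have "h dvd lin_prod v (R d) \<longleftrightarrow> h dvd lin_prod v (filter (\<lambda>r. r \<noteq> 0) (R d))"
    by (metis dvd_monomial_mult)
  finally show ?thesis .
qed

text \<open>A polynomial on one line is its own fibre, so \<open>fibre_eq_slice\<close>, applied to
  any presentation of it, provides the univariate form.\<close>

lemma line_supported_eq_line_poly:
  assumes "v \<noteq> 0" and "supp h \<subseteq> lattice_line a v"
  obtains b p where "h = monomial b 1 * line_poly v p"
proof (cases "h = 0")
  case True
  then have "h = monomial 0 1 * line_poly v []" by simp
  then show ?thesis by (rule that)
next
  case False
  then obtain u where u: "u \<in> supp h" by (metis all_not_in_conv keys_eq_empty)
  obtain ts where ts: "laurent_of ts = h" using laurent_of_surj by blast
  have "u \<in> lattice_line a v" using u assms(2) by blast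
  then have "restr (lattice_line u v) h = h" using assms(2) lattice_line_cong restr_id by metis
  moreover have "u \<in> fst ` set ts" using u supp_laurent_of[of ts] ts by blast
  ultimately have "h = monomial (u - scale (radius ts) v) 1 * line_poly v (slice ts v u)"
    using fibre_eq_slice[OF assms(1)] ts by metis
  then show ?thesis by (rule that)
qed

text \<open>Modulo \<open>X^v - r\<close> the power \<open>X^v\<close> becomes \<open>r\<close>; the
  fold is Horner's evaluation at \<open>r\<close>.\<close>

lemma line_poly_cong_lin:
  "lin v r dvd line_poly v p - monomial 0 (foldr (\<lambda>c s. c + r * s) p 0)"
proof (induction p)
  case (Cons c p)
  let ?e = "foldr (\<lambda>c s. c + r * s) p 0"
  have "line_poly v (c # p) - monomial 0 (c + r * ?e) =
      monomial v 1 * (line_poly v p - monomial 0 ?e) + lin v r * monomial 0 ?e"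
    by (simp add: algebra_simps single_add mult_single)
  with Cons show ?case by simp
qed simp

text \<open>Up to units each factor is congruent to its value at \<open>r\<close>. The product of
  the values is a constant divisible by \<open>lin v r\<close>, hence zero. If \<open>v\<close> is
  not primitive, \<open>lin v r\<close> may split in the whole ring, so primality is claimed only
  among polynomials on lines of direction \<open>v\<close>.\<close>

lemma lin_dvd_mult:
  assumes "v \<noteq> 0" and "r \<noteq> 0"
    and "supp h \<subseteq> lattice_line a v" and "supp q \<subseteq> lattice_line b v"
    and "lin v r dvd h * q"
  shows "lin v r dvd h \<or> lin v r dvd q"
proof -
  obtain s p where h: "h = monomial s 1 * line_poly v p"
    using assms(1,3) by (rule line_supported_eq_line_poly)
  obtain t p' where q: "q = monomial t 1 * line_poly v p'"
    using assms(1,4) by (rule line_supported_eq_line_poly)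
  let ?e = "\<lambda>p. foldr (\<lambda>c s. c + r * s) p 0"
  \<comment> \<open>Replaces one factor by its value at \<open>r\<close>. Two applications turn the
    product into a constant; the instance \<open>g = 1\<close> leads back to the single
    factors.\<close>
  have dvd_iff: "lin v r dvd line_poly v p * g \<longleftrightarrow> lin v r dvd monomial 0 (?e p) * g" for p g
  proof -
    have "lin v r dvd (line_poly v p - monomial 0 (?e p)) * g"
      by (rule dvd_mult2) (rule line_poly_cong_lin)
    then have "lin v r dvd line_poly v p * g - monomial 0 (?e p) * g"
      by (simp add: left_diff_distrib)
    from dvd_add_right_iff[OF this, of "monomial 0 (?e p) * g"] show ?thesis by simp
  qed
  have "h * q = monomial s 1 * (monomial t 1 * (line_poly v p * line_poly v p'))"
    by (simp add: h q ac_simps)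
  with assms(5) have "lin v r dvd line_poly v p * line_poly v p'" by simp
  then have "lin v r dvd line_poly v p' * monomial 0 (?e p)" by (simp add: dvd_iff mult.commute)
  then have "lin v r dvd monomial 0 (?e p * ?e p')" by (simp add: dvd_iff mult_single mult.commute)
  moreover have "2 \<le> card (supp (lin v r))" using card_supp_lin[OF assms(1,2)] by simp
  ultimately have "?e p * ?e p' = 0" using not_dvd_monomial by blast
  then have "?e p = 0 \<or> ?e p' = 0" by simp
  then have "lin v r dvd line_poly v p \<or> lin v r dvd line_poly v p'"
    using dvd_iff[of p 1] dvd_iff[of p' 1] by auto
  then show ?thesis by (simp add: h q)
qed

text \<open>Unique factorisation up to units: \<open>lin v r\<close> divides \<open>h\<close>, and
  \<open>r\<close> joins the subsequence, or it divides the cofactor, and \<open>r\<close> is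
  skipped. In both cases it is cancelled.\<close>

lemma dvd_lin_prod_imp_subseq:
  assumes "v \<noteq> 0" and "0 \<notin> set rs" and "supp h \<subseteq> lattice_line a v" and "h dvd lin_prod v rs"
  shows "\<exists>xs \<in> set (subseqs rs). h dvd lin_prod v xs \<and> lin_prod v xs dvd h"
  using assms(2-)
proof (induction rs arbitrary: h)
  case Nil
  then show ?case by simp
next
  case (Cons r rs)
  let ?\<pi> = "lin v r"
  have r: "r \<noteq> 0" and rs: "0 \<notin> set rs" using Cons.prems(1) by auto
  have \<pi>: "?\<pi> \<noteq> 0" using lin_nonzero[OF assms(1) r] .
  \<comment> \<open>The cofactor must lie on a line as well, since \<open>lin_dvd_mult\<close>
    applies only to such factors.\<close>
  obtain q where q: "supp q \<subseteq> lattice_line (0 - a) v" "lin_prod v (r # rs) = h * q"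
    using Cons.prems(2) supp_lin_prod Cons.prems(3) by (rule dvd_line_cofactor)
  then have hq: "?\<pi> * lin_prod v rs = h * q" by simp
  then have "?\<pi> dvd h * q" by (metis dvd_triv_left)
  from lin_dvd_mult[OF assms(1) r Cons.prems(2) q(1) this]
  show ?case
  proof
    assume "?\<pi> dvd h"
    with supp_lin Cons.prems(2) obtain k
      where k: "supp k \<subseteq> lattice_line (a - 0) v" "h = ?\<pi> * k" by (rule dvd_line_cofactor)
    have "?\<pi> * lin_prod v rs = ?\<pi> * (k * q)" using hq k(2) by (simp add: mult.assoc)
    then have "lin_prod v rs = k * q" using \<pi> by simp
    then have "k dvd lin_prod v rs" by simp
    from Cons.IH[OF rs _ this] k(1) obtain xs where "xs \<in> set (subseqs rs)"
      "k dvd lin_prod v xs" "lin_prod v xs dvd k" by auto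
    then show ?thesis using k(2)
      by (intro bexI[of _ "r # xs"]) (simp_all add: Let_def mult_dvd_mono)
  next
    assume "?\<pi> dvd q"
    then obtain k where k: "q = ?\<pi> * k" by (rule dvdE)
    have "?\<pi> * lin_prod v rs = ?\<pi> * (h * k)" using hq k by (simp add: ac_simps)
    then have "lin_prod v rs = h * k" using \<pi> by simp
    then have "h dvd lin_prod v rs" by simp
    from Cons.IH[OF rs Cons.prems(2) this] show ?thesis by (auto simp: Let_def)
  qed
qed

lemma lin_prod_subseq_dvd: "xs \<in> set (subseqs rs) \<Longrightarrow> lin_prod v xs dvd lin_prod v rs"
  by (induction rs arbitrary: xs) (auto simp: Let_def intro: mult_dvd_mono dvd_mult)

section \<open>Correctness of the two outputs\<close>

lemma set_all_factors:
  "laurent_of ` set (all_factors R ts) = {lin_prod v xs | v d xs. (v, d) \<in> set (line_factors ts) \<and>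
     xs \<in> set (subseqs (filter (\<lambda>r. r \<noteq> 0) (R d))) \<and> xs \<noteq> []}"
  (is "?L = ?R")
proof (intro equalityI subsetI)
  fix g assume "g \<in> ?L"
  then obtain p xs where "p \<in> set (line_factors ts)"
    "xs \<in> set (subseqs (filter (\<lambda>r. r \<noteq> 0) (R (snd p))))" "xs \<noteq> []"
    "g = laurent_of (embed (fst p) (prod_roots xs))"
    unfolding all_factors_def by auto
  then show "g \<in> ?R"
    by (intro CollectI exI[of _ "fst p"] exI[of _ "snd p"] exI[of _ xs])
      (simp add: laurent_of_embed line_poly_prod_roots)
next
  fix g assume "g \<in> ?R"
  then obtain v d xs where vd: "(v, d) \<in> set (line_factors ts)"
    and xs: "xs \<in> set (subseqs (filter (\<lambda>r. r \<noteq> 0) (R d)))" "xs \<noteq> []"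
    and g: "g = lin_prod v xs" by blast
  have "embed v (prod_roots xs) \<in> set (all_factors R ts)"
    unfolding all_factors_def using xs by (auto intro!: bexI[OF _ vd])
  moreover have "g = laurent_of (embed v (prod_roots xs))"
    by (simp add: g laurent_of_embed line_poly_prod_roots)
  ultimately show "g \<in> ?L" by blast
qed

lemma image_pairs: "(\<lambda>p. f (fst p) (snd p)) ` S = {f x y | x y. (x, y) \<in> S}"
  by (simp add: image_def split_paired_Ex Bex_def) metis

lemma set_maximal_factors:
  "laurent_of ts \<noteq> 0 \<Longrightarrow>
    laurent_of ` set (maximal_factors ts) = {line_poly v d | v d. (v, d) \<in> set (line_factors ts)}"
  "laurent_of ts = 0 \<Longrightarrow> laurent_of ` set (maximal_factors ts) = {0}"
proof -
  have zero_iff: "filter (\<lambda>t. coef ts (fst t) \<noteq> 0) ts = [] \<longleftrightarrow> laurent_of ts = 0"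
  proof
    assume "filter (\<lambda>t. coef ts (fst t) \<noteq> 0) ts = []"
    then have "\<forall>u \<in> fst ` set ts. u \<notin> supp (laurent_of ts)"
      by (auto simp: filter_empty_conv coef_eq_lookup in_keys_iff)
    then have "supp (laurent_of ts) = {}" using supp_laurent_of[of ts] by blast
    then show "laurent_of ts = 0" by simp
  qed (simp add: coef_eq_lookup)
  show "laurent_of ` set (maximal_factors ts) = {0}" if "laurent_of ts = 0"
    using that zero_iff by (simp add: maximal_factors_def)
  show "laurent_of ` set (maximal_factors ts) =
      {line_poly v d | v d. (v, d) \<in> set (line_factors ts)}" if "laurent_of ts \<noteq> 0"
  proof -
    have "maximal_factors ts = map (\<lambda>p. embed (fst p) (snd p)) (line_factors ts)"
      using that zero_iff by (simp add: maximal_factors_def)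
    then have "laurent_of ` set (maximal_factors ts) =
        (\<lambda>p. line_poly (fst p) (snd p)) ` set (line_factors ts)"
      by (simp add: image_image laurent_of_embed)
    then show ?thesis unfolding image_pairs .
  qed
qed

lemma maximal_factors_correct:
  fixes ts
  defines "f \<equiv> laurent_of ts" and "G \<equiv> laurent_of ` set (maximal_factors ts)"
  shows "\<forall>g \<in> G. g dvd f \<and> (line_polynomial g \<or> g = 0)"
    and "line_polynomial h \<Longrightarrow> h dvd f \<longleftrightarrow> (\<exists>g \<in> G. h dvd g)"
proof -
  show sound: "\<forall>g \<in> G. g dvd f \<and> (line_polynomial g \<or> g = 0)"
  proof (cases "f = 0")
    case True
    then show ?thesis using set_maximal_factors(2) by (simp add: f_def G_def)
  next
    case False
    show ?thesis
      unfolding G_def set_maximal_factors(1)[OF False[unfolded f_def]]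
      using line_factors_sound(2,3)[of _ _ ts] f_def by blast
  qed
  assume h: "line_polynomial h"
  show "h dvd f \<longleftrightarrow> (\<exists>g \<in> G. h dvd g)"
  proof
    assume hf: "h dvd f"
    show "\<exists>g \<in> G. h dvd g"
    proof (cases "f = 0")
      case True
      then show ?thesis using set_maximal_factors(2) by (simp add: f_def G_def)
    next
      case False
      from line_factors_complete[OF this[unfolded f_def] h hf[unfolded f_def]]
      obtain v d where "(v, d) \<in> set (line_factors ts)" "h dvd line_poly v d" by metis
      then show ?thesis
        unfolding G_def set_maximal_factors(1)[OF False[unfolded f_def]] by blast
    qed
  qed (use sound dvd_trans in blast)
qed

lemma all_factors_correct:
  fixes ts
  assumes "root_finder R" and f: "laurent_of ts \<noteq> 0"
  defines "G \<equiv> laurent_of ` set (all_factors R ts)"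
  shows "\<forall>g \<in> G. line_polynomial g \<and> g dvd laurent_of ts"
    and "line_polynomial h \<Longrightarrow> h dvd laurent_of ts \<Longrightarrow> \<exists>g \<in> G. h dvd g \<and> g dvd h"
proof -
  let ?rs = "\<lambda>d. filter (\<lambda>r. r \<noteq> 0) (R d)"
  have dvd_iff: "h dvd line_poly v d \<longleftrightarrow> h dvd lin_prod v (?rs d)"
    if "(v, d) \<in> set (line_factors ts)" for v d h
  proof (rule line_poly_dvd_lin_prod[OF assms(1)])
    show "line_poly v d \<noteq> 0" using line_factors_sound(3)[OF that] f by (metis dvd_0_left)
  qed
  show "\<forall>g \<in> G. line_polynomial g \<and> g dvd laurent_of ts"
  proof
    fix g assume "g \<in> G"
    then obtain v d xs where vd: "(v, d) \<in> set (line_factors ts)"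
      and xs: "xs \<in> set (subseqs (?rs d))" "xs \<noteq> []" and g: "g = lin_prod v xs"
      unfolding G_def set_all_factors by blast
    have "g dvd line_poly v d" using lin_prod_subseq_dvd[OF xs(1)] dvd_iff[OF vd] g by blast
    then have dvd: "g dvd laurent_of ts" using line_factors_sound(3)[OF vd] by (rule dvd_trans)
    have v: "v \<noteq> 0" using line_factors_sound(1)[OF vd] .
    obtain r ys where ys: "xs = r # ys" using xs(2) by (cases xs) auto
    have "set xs \<in> Pow (set (?rs d))" using xs(1) subseqs_powset[of "?rs d"] by blast
    then have "r \<noteq> 0" using ys by auto
    \<comment> \<open>A nonempty product is a multiple of a binomial and, as a divisor of
      \<open>f\<close>, nonzero; hence it has at least two exponents.\<close>
    then have "2 \<le> card (supp (lin v r))" using card_supp_lin[OF v] by simp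
    moreover have "lin v r dvd g" by (simp add: g ys)
    moreover have "g \<noteq> 0" using dvd f by (metis dvd_0_left)
    ultimately have "2 \<le> card (supp g)" by (rule two_le_card_supp_dvd)
    with dvd line_polynomialI[OF v supp_lin_prod] show "line_polynomial g \<and> g dvd laurent_of ts"
      unfolding g by blast
  qed
  assume h: "line_polynomial h" and hf: "h dvd laurent_of ts"
  obtain v d a where vd: "(v, d) \<in> set (line_factors ts)" and a: "supp h \<subseteq> lattice_line a v"
    and hd: "h dvd line_poly v d"
    using f h hf by (rule line_factors_complete)
  have "0 \<notin> set (?rs d)" by simp
  from dvd_lin_prod_imp_subseq[OF line_factors_sound(1)[OF vd] this a] hd dvd_iff[OF vd]
  obtain xs where xs: "xs \<in> set (subseqs (?rs d))" "h dvd lin_prod v xs" "lin_prod v xs dvd h"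
    by blast
  \<comment> \<open>Rules out the empty subsequence, whose product is \<open>1\<close>.\<close>
  have "\<not> h dvd 1" using h not_dvd_monomial[of h 1 0] by (simp add: line_polynomial_def)
  then have "xs \<noteq> []" using xs(2) by auto
  then have "lin_prod v xs \<in> G" unfolding G_def set_all_factors using vd xs(1) by blast
  then show "\<exists>g \<in> G. h dvd g \<and> g dvd h" using xs(2,3) by blast
qed

text \<open>The first program uses field operations and zero tests and returns factors that together
  capture every line polynomial divisor; the alternative \<open>g = 0\<close> accommodates
  \<open>f = 0\<close>. The second lists all line polynomial divisors up to units, with one program
  for all root finders. There \<open>f \<noteq> 0\<close> is assumed because the zero polynomial has
  infinitely many divisors of this kind that are pairwise not associated.\<close>

theorem theorem6:
  shows "(\<exists>P. root_free P \<and>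
            (\<forall>R (f :: laurent) ts. laurent_of ts = f \<longrightarrow>
               (\<exists>gs. run R P (terms_val ts) (terms_list_val gs) \<and>
                 (\<forall>g \<in> laurent_of ` set gs. g dvd f \<and> (line_polynomial g \<or> g = 0)) \<and>
                 (\<forall>h. line_polynomial h \<longrightarrow>
                    (h dvd f \<longleftrightarrow> (\<exists>g \<in> laurent_of ` set gs. h dvd g)))))) \<and>
         (\<exists>P. \<forall>R. root_finder R \<longrightarrow>
            (\<forall>(f :: laurent) ts. laurent_of ts = f \<and> f \<noteq> 0 \<longrightarrow>
               (\<exists>gs. run R P (terms_val ts) (terms_list_val gs) \<and>
                 (\<forall>g \<in> laurent_of ` set gs. line_polynomial g \<and> g dvd f) \<and>
                 (\<forall>h. line_polynomial h \<and> h dvd f \<longrightarrow>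
                    (\<exists>g \<in> laurent_of ` set gs. h dvd g \<and> g dvd h)))))"
proof
  obtain P where P: "root_free P"
      "\<And>R ts. run R P (terms_val ts) (terms_list_val (maximal_factors ts))"
    using computable_maximal_factors[of True] unfolding computable_def enc_terms enc_terms_list
    by blast
  show "\<exists>P. root_free P \<and> (\<forall>R (f :: laurent) ts. laurent_of ts = f \<longrightarrow>
      (\<exists>gs. run R P (terms_val ts) (terms_list_val gs) \<and>
        (\<forall>g \<in> laurent_of ` set gs. g dvd f \<and> (line_polynomial g \<or> g = 0)) \<and>
        (\<forall>h. line_polynomial h \<longrightarrow> (h dvd f \<longleftrightarrow> (\<exists>g \<in> laurent_of ` set gs. h dvd g)))))"
  proof (intro exI[of _ P] conjI allI impI P(1))
    fix R ts and f :: laurent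
    assume f: "laurent_of ts = f"
    show "\<exists>gs. run R P (terms_val ts) (terms_list_val gs) \<and>
        (\<forall>g \<in> laurent_of ` set gs. g dvd f \<and> (line_polynomial g \<or> g = 0)) \<and>
        (\<forall>h. line_polynomial h \<longrightarrow> (h dvd f \<longleftrightarrow> (\<exists>g \<in> laurent_of ` set gs. h dvd g)))"
      unfolding f[symmetric]
      by (intro exI[of _ "maximal_factors ts"] conjI allI impI P(2) maximal_factors_correct)
  qed
next
  obtain P where P: "\<And>R ts. run R P (terms_val ts) (terms_list_val (all_factors R ts))"
    using computable_all_factors unfolding computable_def enc_terms enc_terms_list by blast
  show "\<exists>P. \<forall>R. root_finder R \<longrightarrow> (\<forall>(f :: laurent) ts. laurent_of ts = f \<and> f \<noteq> 0 \<longrightarrow>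
      (\<exists>gs. run R P (terms_val ts) (terms_list_val gs) \<and>
        (\<forall>g \<in> laurent_of ` set gs. line_polynomial g \<and> g dvd f) \<and>
        (\<forall>h. line_polynomial h \<and> h dvd f \<longrightarrow> (\<exists>g \<in> laurent_of ` set gs. h dvd g \<and> g dvd h))))"
  proof (intro exI[of _ P] allI impI)
    fix R ts and f :: laurent
    assume R: "root_finder R" and "laurent_of ts = f \<and> f \<noteq> 0"
    then have f: "f = laurent_of ts" and nz: "laurent_of ts \<noteq> 0" by auto
    show "\<exists>gs. run R P (terms_val ts) (terms_list_val gs) \<and>
        (\<forall>g \<in> laurent_of ` set gs. line_polynomial g \<and> g dvd f) \<and>
        (\<forall>h. line_polynomial h \<and> h dvd f \<longrightarrow> (\<exists>g \<in> laurent_of ` set gs. h dvd g \<and> g dvd h))"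
      unfolding f
      by (intro exI[of _ "all_factors R ts"] conjI allI impI P all_factors_correct[OF R nz]) auto
  qed
qed

end
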